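(* For every integer $n\ge 0$, $$\mathrm{SEDO}(7n+5)-\mathrm{SODO}(7n+5)\equiv 0 \pmod 7.$$
   Context: A partition of $n$ without repeated odd parts is a partition of $n$ in which each odd part occurs at most once (even parts may be repeated without restriction). $\mathrm{SEDO}(n)$ and $\mathrm{SODO}(n)$ denote, respectively, the sum of all the even parts (counted with multiplicity) and the sum of all the odd parts in all the partitions of $n$ without repeated odd parts. *)

theory Defs
  imports "HOL-Library.Multiset" "HOL-Number_Theory.Cong"
begin

definition partitions :: "nat \<Rightarrow> nat multiset set" where
  "partitions n = {P. 0 \<notin># P \<and> sum_mset P = n}"

definition partitions_no_rep_odd :: "nat \<Rightarrow> nat multiset set" where
  "partitions_no_rep_odd n = {P \<in> partitions n. \<forall>k. odd k \<longrightarrow> count P k \<le> 1}"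

text \<open>\<^const>\<open>filter_mset\<close> preserves multiplicities, so repeated even parts are summed
  with multiplicity.\<close>

definition SEDO :: "nat \<Rightarrow> nat" where
  "SEDO n = (\<Sum>P\<in>partitions_no_rep_odd n. sum_mset (filter_mset even P))"

definition SODO :: "nat \<Rightarrow> nat" where
  "SODO n = (\<Sum>P\<in>partitions_no_rep_odd n. sum_mset (filter_mset odd P))"

text \<open>The index set of these sums is finite, so they do not collapse to the value \<open>0\<close> that
  \<^const>\<open>sum\<close> takes on infinite sets.\<close>

lemma size_le_sum_mset:
  fixes P :: "nat multiset"
  assumes "0 \<notin># P"
  shows "size P \<le> sum_mset P"
  using assms by (induction P) auto

lemma finite_partitions: "finite (partitions n)"
proof (rule finite_subset)
  show "partitions n \<subseteq> mset ` {xs. set xs \<subseteq> {..n} \<and> length xs \<le> n}"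
  proof
    fix P assume P: "P \<in> partitions n"
    obtain xs where xs: "mset xs = P" using ex_mset by blast
    have "length xs \<le> n"
      using size_le_sum_mset[of P] P xs by (auto simp: partitions_def)
    moreover have "set xs \<subseteq> {..n}"
      using P xs member_le_sum_list[of _ xs]
      by (auto simp: partitions_def sum_mset_sum_list[symmetric] simp del: sum_mset_sum_list)
    ultimately show "P \<in> mset ` {xs. set xs \<subseteq> {..n} \<and> length xs \<le> n}"
      using xs by blast
  qed
  show "finite (mset ` {xs. set xs \<subseteq> {..n} \<and> length xs \<le> n})"
    by (intro finite_imageI finite_lists_length_le) simp
qed

lemma finite_partitions_no_rep_odd: "finite (partitions_no_rep_odd n)"
  using finite_partitions[of n] by (simp add: partitions_no_rep_odd_def)

end

theory Submission
  imports Defs "HOL-Computational_Algebra.Formal_Power_Series"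
begin

text \<open>
  Let \<open>D\<close> be the generating function of \<open>SEDO n - SODO n\<close>, put \<open>E = \<Prod>(1 - X\<^sup>2\<^sup>k)\<close> and
  \<open>G = \<Prod>(1 - (-X)\<^sup>k)\<close> over all \<open>k \<ge> 1\<close>, and let \<open>\<theta> = X d/dX\<close>. Marking even parts and odd parts
  separately turns the sums of parts into logarithmic derivatives. The partitions themselves are
  counted by \<open>G / E\<^sup>2\<close>, and the difference of the two logarithmic derivatives is \<open>-\<theta> G / G\<close>, which
  gives \<open>D E\<^sup>2 = -\<theta> G\<close> (lemma \<open>sedo_sodo_gf_product\<close>).

  The idea is to trade \<open>\<theta> G\<close> for \<open>\<theta> (G\<^sup>3) = 3 G\<^sup>2 \<theta> G\<close>, because both \<open>G\<^sup>3\<close> and \<open>E\<^sup>5 / G\<^sup>2\<close> are theta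
  series with linear weights:
  \<^item> \<open>2 G\<^sup>3\<close> is the sum over all integers \<open>j\<close> of \<open>\<plusminus>(2j + 1)\<close> times \<open>X\<close> to the power \<open>j(j + 1)/2\<close>
    (Jacobi's identity, lemma \<open>jacobi_cube\<close>);
  \<^item> \<open>L = E\<^sup>5 / G\<^sup>2\<close> is the sum over all integers \<open>m\<close> of \<open>3m + 1\<close> times \<open>X\<close> to the power
    \<open>3m\<^sup>2 + 2m\<close> (a specialisation of the quintuple product identity, lemma
    \<open>linear_theta_product\<close>).

  Together they yield \<open>L \<theta>(2 G\<^sup>3) = -6 E\<^sup>7 D\<close>. On the left a term with exponent \<open>N\<close> satisfies
  \<open>24 N + 11 = 3 x\<^sup>2 + 8 y\<^sup>2\<close> with \<open>x = 2j + 1\<close> and \<open>y = 3m + 1\<close>, and its coefficient is, up to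
  sign, \<open>y x (x\<^sup>2 - 1) / 8\<close>. If \<open>N\<close> is \<open>5\<close> modulo \<open>7\<close>, the quadratic form forces \<open>y\<close> to be \<open>0\<close> or \<open>x\<close> to be
  \<open>\<plusminus>1\<close> modulo \<open>7\<close>, so every single term is divisible by \<open>7\<close> (lemma \<open>seven_dvd_weight\<close>). On the
  right, \<open>E\<^sup>7\<close> is modulo \<open>7\<close> a series in \<open>X\<^sup>7\<close> with constant term \<open>1\<close>, so it does not mix residue
  classes of exponents and can be cancelled (lemma \<open>dvd_coeff_cancel_power\<close>).

  The theta series come from one finite identity, \<open>finite_theta_product\<close>, whose limit for
  \<open>n \<rightarrow> \<infinity>\<close> contains both Jacobi's triple product and his identity for the cube. The formula
  for \<open>L\<close> is then an identity between two binary theta series, proved by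
  rearranging the representations of a number by a form (lemma \<open>quadratic_form_sum\<close>).
\<close>

section \<open>Gaussian binomial coefficients\<close>

text \<open>
  \<open>qbinom q l r\<close> is the Gaussian binomial coefficient of \<open>l + r\<close> over \<open>l\<close>. Indexing by the two
  complementary lower entries makes the symmetry visible, and the definition by Pascal's rule
  makes sense in every commutative ring, where the quotient of products need not exist.
\<close>
fun qbinom :: "'a::comm_ring_1 \<Rightarrow> nat \<Rightarrow> nat \<Rightarrow> 'a" where
  "qbinom q 0 r = 1"
| "qbinom q (Suc l) 0 = 1"
| "qbinom q (Suc l) (Suc r) = qbinom q l (Suc r) + q ^ Suc l * qbinom q (Suc l) r"

lemma qbinom_0_right [simp]: "qbinom q l 0 = 1"
  by (cases l) auto

definition qpoch :: "'a::comm_ring_1 \<Rightarrow> nat \<Rightarrow> 'a" where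
  "qpoch q n = (\<Prod>k<n. 1 - q ^ Suc k)"

lemma qpoch_0 [simp]: "qpoch q 0 = 1"
  and qpoch_Suc [simp]: "qpoch q (Suc n) = qpoch q n * (1 - q ^ Suc n)"
  by (simp_all add: qpoch_def)

lemma qbinom_times_qpoch: "qbinom q l r * qpoch q l * qpoch q r = qpoch q (l + r)"
proof (induction q l r rule: qbinom.induct)
  case (3 q l r)
  have "qbinom q (Suc l) (Suc r) * qpoch q (Suc l) * qpoch q (Suc r) =
      (qbinom q l (Suc r) * qpoch q l * qpoch q (Suc r)) * (1 - q ^ Suc l)
      + (qbinom q (Suc l) r * qpoch q (Suc l) * qpoch q r) * (q ^ Suc l * (1 - q ^ Suc r))"
    by (simp only: qbinom.simps qpoch_Suc) (simp add: algebra_simps)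
  also have "\<dots> = qpoch q (l + Suc r) * (1 - q ^ Suc l) + qpoch q (Suc l + r) * (q ^ Suc l * (1 - q ^ Suc r))"
    by (simp only: 3)
  also have "\<dots> = qpoch q (Suc l + Suc r)"
    by (simp add: algebra_simps power_add)
  finally show ?case .
qed auto

text \<open>
  This is the mirror image of the defining Pascal rule. Since the definition treats \<open>l\<close> and \<open>r\<close>
  differently and a quotient formula is not available in a general ring, it is proved by expanding
  once more on both sides, which leads to the same four terms.
\<close>
lemma qbinom_Suc_Suc':
  "qbinom q (Suc l) (Suc r) = q ^ Suc r * qbinom q l (Suc r) + qbinom q (Suc l) r"
proof (induction "l + r" arbitrary: l r rule: less_induct)
  case less
  show ?case
  proof (cases l)
    case l: 0
    show ?thesis
    proof (cases r)
      case 0 then show ?thesis using l by simp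
    next
      case (Suc r')
      then show ?thesis using less[of 0 r'] l by (simp add: algebra_simps)
    qed
  next
    case l: (Suc l')
    show ?thesis
    proof (cases r)
      case 0
      have "qbinom q l (Suc 0) = q * qbinom q l' (Suc 0) + 1"
        using less[of l' 0] l 0 by simp
      then have "qbinom q (Suc l) (Suc 0) = (q * qbinom q l' (Suc 0) + 1) + q ^ Suc l"
        by simp
      also have "\<dots> = q * qbinom q l (Suc 0) + 1"
        using l by (simp add: algebra_simps)
      finally show ?thesis using 0 by simp
    next
      case r: (Suc r')
      have 1: "qbinom q (Suc l') (Suc r) = q ^ Suc r * qbinom q l' (Suc r) + qbinom q (Suc l') r"
        using less[of l' r] l by simp
      have 2: "qbinom q (Suc l) (Suc r') = q ^ Suc r' * qbinom q l (Suc r') + qbinom q (Suc l) r'"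
        using less[of l r'] r by simp
      have 3: "qbinom q l (Suc r) = qbinom q l' (Suc r) + q ^ Suc l' * qbinom q l r"
        using l by simp
      have 4: "qbinom q (Suc l) r = qbinom q l r + q ^ Suc l * qbinom q (Suc l) r'"
        using r by simp
      have "qbinom q (Suc l) (Suc r) = qbinom q l (Suc r) + q ^ Suc l * qbinom q (Suc l) r"
        by simp
      also have "\<dots> = (q ^ Suc r * qbinom q l' (Suc r) + qbinom q l r)
          + q ^ Suc l * (q ^ r * qbinom q l r + qbinom q (Suc l) r')"
        using 1 2 l r by simp
      also have "\<dots> = q ^ Suc r * (qbinom q l' (Suc r) + q ^ l * qbinom q l r)
          + (qbinom q l r + q ^ Suc l * qbinom q (Suc l) r')"
        by (simp add: algebra_simps)
      finally show ?thesis using 3 4 l by simp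
    qed
  qed
qed

text \<open>
  Extending by zero to negative indices removes all boundary cases from the three-term recurrence
  below and from the sums that it is applied to.
\<close>
definition qbin :: "'a::comm_ring_1 \<Rightarrow> int \<Rightarrow> int \<Rightarrow> 'a" where
  "qbin q l r = (if l < 0 \<or> r < 0 then 0 else qbinom q (nat l) (nat r))"

text \<open>
  Applying Pascal's rule twice, in its two forms, relates the coefficients with total \<open>l + r + 2\<close> to
  those with total \<open>l + r\<close>. This is how the coefficients of a product in \<open>z\<close> and \<open>1/z\<close> change when it
  is multiplied by one more factor of each kind.
\<close>
lemma qbin_rec:
  assumes "l \<ge> -1" "r \<ge> -1" "l + r \<ge> 0"
  shows "qbin q (l + 1) (r + 1) = (1 + q ^ nat (l + r + 1)) * qbin q l r
     + q ^ nat (l + 1) * qbin q (l + 1) (r - 1) + q ^ nat (r + 1) * qbin q (l - 1) (r + 1)"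
proof -
  consider "l = -1" "r \<ge> 1" | "r = -1" "l \<ge> 1" | "l \<ge> 0" "r \<ge> 0"
    using assms by linarith
  then show ?thesis
  proof cases
    case 3
    then obtain a b where ab: "l = int a" "r = int b"
      by (metis nonneg_int_cases)
    have *: "nat (1 + int x) = Suc x" for x by simp
    have "qbinom q (Suc a) (Suc b) = qbin q l (r + 1) + q ^ Suc a * qbin q (l + 1) r"
      using ab by (simp add: qbin_def * add.commute)
    moreover have "qbin q l (r + 1) = q ^ Suc b * qbin q (l - 1) (r + 1) + qbin q l r"
      using ab by (cases a) (simp_all add: qbin_def * add.commute qbinom_Suc_Suc' del: qbinom.simps(3))
    moreover have "qbin q (l + 1) r = q ^ b * qbin q l r + qbin q (l + 1) (r - 1)"
      using ab by (cases b) (simp_all add: qbin_def * add.commute qbinom_Suc_Suc' del: qbinom.simps(3))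
    moreover have "nat (l + r + 1) = Suc (a + b)" using ab by simp
    ultimately show ?thesis using ab
      by (simp add: qbin_def * add.commute[of _ 1] algebra_simps power_add del: qbinom.simps(3))
  qed (auto simp: qbin_def)
qed

section \<open>A finite theta product\<close>

lemma shift_sum_int:
  fixes f :: "int \<Rightarrow> 'a::comm_monoid_add"
  shows "(\<Sum>i\<in>{a..b}. f (i + c)) = (\<Sum>j\<in>{a + c..b + c}. f j)"
  by (rule sum.reindex_bij_witness[of _ "\<lambda>j. j - c" "\<lambda>i. i + c"]) auto

text \<open>
  The left hand side grows by the factor \<open>1 + q\<^sup>2\<^sup>n\<^sup>+\<^sup>s\<^sup>+\<^sup>1 - lam n\<close> when \<open>n\<close> is increased:
  the recurrence \<open>qbin_rec\<close> replaces each weight \<open>t i\<close> by a combination of \<open>t i\<close>, \<open>t (i + 1)\<close> and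
  \<open>t (i - 1)\<close>, and \<open>rec\<close> says that the two neighbours contribute a multiple of \<open>t i\<close> that does not
  depend on \<open>i\<close>. Keeping \<open>t\<close> abstract covers the triple product (\<open>s = 0\<close>) as well as
  Jacobi's cube (\<open>s = 1\<close>, weights linear in \<open>i\<close>), without differentiating with respect to a parameter.
\<close>
lemma finite_theta_product:
  fixes q :: "'a::comm_ring_1" and t :: "int \<Rightarrow> 'a" and lam :: "nat \<Rightarrow> 'a" and s :: nat
  assumes rec: "\<And>n i. - int n - int s \<le> i \<Longrightarrow> i \<le> int n \<Longrightarrow>
    q ^ nat (int n - i) * t (i + 1) + q ^ nat (int n + int s + i) * t (i - 1) = - (lam n * t i)"
  shows "(\<Sum>j\<in>{- int n - int s..int n}. qbin q (int n - j) (int n + int s + j) * t j)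
    = (\<Sum>j\<in>{- int s..0}. qbin q (- j) (int s + j) * t j) * (\<Prod>k<n. 1 + q ^ (2 * k + s + 1) - lam k)"
proof (induction n)
  case (Suc n)
  define m where "m = int n"
  define I where "I = {- m - int s..m}"
  define I' where "I' = {- m - int s - 1..m + 1}"
  define b where "b = (\<lambda>j. qbin q (m - j) (m + int s + j))"
  have b0: "b j = 0" if "j \<notin> I" for j using that by (auto simp: b_def I_def qbin_def)
  have fin: "finite I'" by (simp add: I'_def)
  have n': "int (Suc n) = m + 1" by (simp add: m_def)
  have "(\<Sum>j\<in>{- int (Suc n) - int s..int (Suc n)}. qbin q (int (Suc n) - j) (int (Suc n) + int s + j) * t j)
    = (\<Sum>j\<in>I'. qbin q (m - j + 1) (m + int s + j + 1) * t j)"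
    unfolding n' I'_def by (rule sum.cong) (auto simp: algebra_simps)
  also have "\<dots> = (\<Sum>j\<in>I'. (1 + q ^ (2 * n + s + 1)) * (b j * t j)
      + q ^ nat (m - (j - 1)) * (b (j - 1) * t j) + q ^ nat (m + int s + (j + 1)) * (b (j + 1) * t j))"
  proof (rule sum.cong[OF refl])
    fix j assume j: "j \<in> I'"
    have e: "nat (m - j + (m + int s + j) + 1) = 2 * n + s + 1" by (simp add: m_def)
    have "qbin q (m - j + 1) (m + int s + j + 1) = (1 + q ^ nat (m - j + (m + int s + j) + 1)) * qbin q (m - j) (m + int s + j)
     + q ^ nat (m - j + 1) * qbin q (m - j + 1) (m + int s + j - 1) + q ^ nat (m + int s + j + 1) * qbin q (m - j - 1) (m + int s + j + 1)"
      by (rule qbin_rec) (use j in \<open>auto simp: I'_def m_def\<close>)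
    then show "qbin q (m - j + 1) (m + int s + j + 1) * t j = (1 + q ^ (2 * n + s + 1)) * (b j * t j)
      + q ^ nat (m - (j - 1)) * (b (j - 1) * t j) + q ^ nat (m + int s + (j + 1)) * (b (j + 1) * t j)"
      unfolding e by (simp add: b_def algebra_simps)
  qed
  also have "\<dots> = (\<Sum>j\<in>I'. (1 + q ^ (2 * n + s + 1)) * (b j * t j))
      + (\<Sum>j\<in>I'. q ^ nat (m - (j - 1)) * (b (j - 1) * t j)) + (\<Sum>j\<in>I'. q ^ nat (m + int s + (j + 1)) * (b (j + 1) * t j))"
    by (simp add: sum.distrib)
  also have "(\<Sum>j\<in>I'. (1 + q ^ (2 * n + s + 1)) * (b j * t j)) = (\<Sum>i\<in>I. (1 + q ^ (2 * n + s + 1)) * (b i * t i))"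
    by (rule sum.mono_neutral_right) (auto simp: fin b0, auto simp: I_def I'_def)
  also have "(\<Sum>j\<in>I'. q ^ nat (m - (j - 1)) * (b (j - 1) * t j)) = (\<Sum>j\<in>{- m - int s + 1..m + 1}. q ^ nat (m - (j - 1)) * (b (j - 1) * t j))"
  proof (rule sum.mono_neutral_right[OF fin], goal_cases)
    case 2
    have "b (j - 1) = 0" if "j \<in> I' - {- m - int s + 1..m + 1}" for j
      using that by (intro b0) (auto simp: I'_def I_def)
    then show ?case by simp
  qed (auto simp: I'_def)
  also have "\<dots> = (\<Sum>i\<in>I. q ^ nat (m - i) * (b i * t (i + 1)))"
    unfolding I_def by (subst shift_sum_int[symmetric]) simp
  also have "(\<Sum>j\<in>I'. q ^ nat (m + int s + (j + 1)) * (b (j + 1) * t j)) = (\<Sum>j\<in>{- m - int s + (-1)..m + (-1)}. q ^ nat (m + int s + (j + 1)) * (b (j + 1) * t j))"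
  proof (rule sum.mono_neutral_right[OF fin], goal_cases)
    case 2
    have "b (j + 1) = 0" if "j \<in> I' - {- m - int s + (-1)..m + (-1)}" for j
      using that by (intro b0) (auto simp: I'_def I_def)
    then show ?case by simp
  qed (auto simp: I'_def)
  also have "\<dots> = (\<Sum>i\<in>I. q ^ nat (m + int s + i) * (b i * t (i - 1)))"
    unfolding I_def by (subst shift_sum_int[symmetric]) simp
  also have "(\<Sum>i\<in>I. (1 + q ^ (2 * n + s + 1)) * (b i * t i)) + (\<Sum>i\<in>I. q ^ nat (m - i) * (b i * t (i + 1)))
      + (\<Sum>i\<in>I. q ^ nat (m + int s + i) * (b i * t (i - 1)))
    = (\<Sum>i\<in>I. b i * t i * (1 + q ^ (2 * n + s + 1) - lam n))"
    unfolding sum.distrib[symmetric]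
  proof (rule sum.cong[OF refl])
    fix i assume i: "i \<in> I"
    have "q ^ nat (m - i) * t (i + 1) + q ^ nat (m + int s + i) * t (i - 1) = - (lam n * t i)"
      unfolding m_def by (rule rec) (use i in \<open>auto simp: I_def m_def\<close>)
    then have "b i * (q ^ nat (m - i) * t (i + 1) + q ^ nat (m + int s + i) * t (i - 1)) = b i * (- (lam n * t i))"
      by simp
    then show "(1 + q ^ (2 * n + s + 1)) * (b i * t i) + q ^ nat (m - i) * (b i * t (i + 1)) + q ^ nat (m + int s + i) * (b i * t (i - 1))
      = b i * t i * (1 + q ^ (2 * n + s + 1) - lam n)"
      by (simp add: algebra_simps)
  qed
  also have "\<dots> = (\<Sum>i\<in>I. b i * t i) * (1 + q ^ (2 * n + s + 1) - lam n)"
    by (simp add: sum_distrib_right)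
  finally show ?case using Suc.IH unfolding I_def b_def m_def by (simp add: mult.assoc)
qed auto

section \<open>Limits of formal power series\<close>

lemma eventually_fps_nth_le:
  assumes "(f \<longlongrightarrow> (A :: 'a::group_add fps)) F"
  shows "\<forall>\<^sub>F x in F. \<forall>i\<le>N. fps_nth (f x) i = fps_nth A i"
proof -
  have "\<forall>\<^sub>F x in F. \<forall>i\<in>{..N}. fps_nth (f x) i = fps_nth A i"
    using assms unfolding tendsto_fps_iff by (intro eventually_ball_finite) auto
  then show ?thesis by (simp add: atMost_def)
qed

lemma tendsto_fps_mult:
  fixes A B :: "'a::comm_ring_1 fps"
  assumes "(f \<longlongrightarrow> A) F" "(g \<longlongrightarrow> B) F"
  shows "((\<lambda>x. f x * g x) \<longlongrightarrow> A * B) F"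
proof (rule tendsto_fpsI)
  fix n
  show "\<forall>\<^sub>F x in F. fps_nth (f x * g x) n = fps_nth (A * B) n"
    using eventually_fps_nth_le[OF assms(1), of n] eventually_fps_nth_le[OF assms(2), of n]
    by eventually_elim (simp add: fps_mult_nth)
qed

lemma tendsto_fps_power:
  fixes A :: "'a::comm_ring_1 fps"
  assumes "(f \<longlongrightarrow> A) F"
  shows "((\<lambda>x. f x ^ k) \<longlongrightarrow> A ^ k) F"
  by (induction k) (auto intro: tendsto_fps_mult assms)

text \<open>
  A factor whose limit has constant term \<open>1\<close> can be cancelled, because the coefficients of the
  other factor are then determined recursively by those of the product. This replaces dividing by
  infinite products.
\<close>
lemma tendsto_fps_cancel:
  fixes A C :: "'a::comm_ring_1 fps"
  assumes f: "(f \<longlongrightarrow> C) F" and fh: "((\<lambda>x. f x * h x) \<longlongrightarrow> C * A) F" and C: "fps_nth C 0 = 1"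
  shows "(h \<longlongrightarrow> A) F"
proof (rule tendsto_fpsI)
  fix n
  show "\<forall>\<^sub>F x in F. fps_nth (h x) n = fps_nth A n"
    using eventually_fps_nth_le[OF f, of n] eventually_fps_nth_le[OF fh, of n]
  proof eventually_elim
    case (elim x)
    have "i \<le> n \<Longrightarrow> fps_nth (h x) i = fps_nth A i" for i
    proof (induction i rule: less_induct)
      case (less i)
      have *: "fps_nth (C * g) i = fps_nth g i + (\<Sum>k=1..i. fps_nth C k * fps_nth g (i - k))" for g
        using C by (simp add: fps_mult_nth sum.atLeast_Suc_atMost[of 0])
      have "fps_nth (C * h x) i = fps_nth (f x * h x) i"
        using elim(1) less.prems by (simp add: fps_mult_nth)
      also have "\<dots> = fps_nth (C * A) i" using elim(2) less.prems by simp
      finally have "fps_nth (C * h x) i = fps_nth (C * A) i" .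
      moreover have "(\<Sum>k=1..i. fps_nth C k * fps_nth (h x) (i - k)) = (\<Sum>k=1..i. fps_nth C k * fps_nth A (i - k))"
        using less by (intro sum.cong) auto
      ultimately show ?case unfolding * by simp
    qed
    then show ?case by simp
  qed
qed

text \<open>
  The formal series \<open>\<Sum>\<^sub>j w j X\<^bsup>e j\<^esup>\<close>. It is meaningful only if every exponent is taken finitely often,
  which the lemmas below assume.
\<close>
definition theta_series :: "('i \<Rightarrow> int) \<Rightarrow> ('i \<Rightarrow> nat) \<Rightarrow> int fps" where
  "theta_series w e = Abs_fps (\<lambda>N. \<Sum>j | e j = N. w j)"

lemma theta_series_nth: "fps_nth (theta_series w e) N = (\<Sum>j | e j = N. w j)"
  by (simp add: theta_series_def)

lemma theta_series_mult_nth: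
  assumes fe: "\<And>N. finite {i. e i = N}" and fh: "\<And>N. finite {j. h j = N}"
  shows "fps_nth (theta_series w e * theta_series v h) N = (\<Sum>(i, j) | e i + h j = N. w i * v j)"
    and "finite {(i, j). e i + h j = (N::nat)}"
proof -
  have eq: "{(i, j). e i + h j = N} = (\<Union>k\<in>{0..N}. {i. e i = k} \<times> {j. h j = N - k})"
    by auto
  show "finite {(i, j). e i + h j = N}"
    unfolding eq using fe fh by auto
  have "fps_nth (theta_series w e * theta_series v h) N
      = (\<Sum>k\<in>{0..N}. \<Sum>(i, j)\<in>{i. e i = k} \<times> {j. h j = N - k}. w i * v j)"
    by (simp add: fps_mult_nth theta_series_nth sum_product sum.cartesian_product)
  also have "\<dots> = (\<Sum>(i, j) | e i + h j = N. w i * v j)"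
    unfolding eq by (rule sum.UNION_disjoint[symmetric]) (use fe fh in auto)
  finally show "fps_nth (theta_series w e * theta_series v h) N = (\<Sum>(i, j) | e i + h j = N. w i * v j)" .
qed

text \<open>
  Dominated convergence for formal series: only the finitely many \<open>j\<close> with \<open>e j \<le> N\<close> influence the
  coefficient of index \<open>N\<close>, so termwise convergence is enough.
\<close>
lemma tendsto_theta_series:
  fixes c :: "nat \<Rightarrow> 'i \<Rightarrow> int fps"
  assumes fin: "\<And>N. finite {j. e j = N}" and I: "\<And>n. finite (I n)"
    and ev: "\<And>j. \<forall>\<^sub>F n in sequentially. j \<in> I n"
    and c: "\<And>j. (\<lambda>n. c n j) \<longlonglongrightarrow> 1"
  shows "(\<lambda>n. \<Sum>j\<in>I n. c n j * (fps_const (w j) * fps_X ^ e j)) \<longlonglongrightarrow> theta_series w e"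
proof (rule tendsto_fpsI)
  fix N
  define J where "J = {j. e j \<le> N}"
  have J: "finite J"
  proof -
    have "J = (\<Union>k\<le>N. {j. e j = k})" by (auto simp: J_def)
    then show ?thesis using fin by simp
  qed
  have "\<forall>\<^sub>F n in sequentially. \<forall>j\<in>J. j \<in> I n"
    using J ev by (intro eventually_ball_finite) auto
  moreover have "\<forall>\<^sub>F n in sequentially. \<forall>j\<in>J. \<forall>i\<le>N. fps_nth (c n j) i = fps_nth 1 i"
    by (intro eventually_ball_finite J ballI eventually_fps_nth_le c)
  ultimately show "\<forall>\<^sub>F n in sequentially.
      fps_nth (\<Sum>j\<in>I n. c n j * (fps_const (w j) * fps_X ^ e j)) N = fps_nth (theta_series w e) N"
  proof eventually_elim
    case (elim n)
    have t: "fps_nth (c n j * (fps_const (w j) * fps_X ^ e j)) N = (if e j \<le> N then w j * fps_nth (c n j) (N - e j) else 0)" for j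
      by (simp add: mult.left_commute fps_X_power_mult_right_nth)
    have "fps_nth (\<Sum>j\<in>I n. c n j * (fps_const (w j) * fps_X ^ e j)) N
        = (\<Sum>j\<in>I n. if e j \<le> N then w j * fps_nth (c n j) (N - e j) else 0)"
      by (simp add: fps_sum_nth t)
    also have "\<dots> = (\<Sum>j\<in>J. if e j \<le> N then w j * fps_nth (c n j) (N - e j) else 0)"
      by (rule sum.mono_neutral_right) (use elim(1) I in \<open>auto simp: J_def\<close>)
    also have "\<dots> = (\<Sum>j\<in>J. if e j = N then w j else 0)"
      by (rule sum.cong) (use elim(2) in \<open>auto simp: J_def\<close>)
    also have "\<dots> = (\<Sum>j | e j = N. w j)"
      using J by (subst sum.inter_filter[symmetric]) (auto simp: J_def intro!: sum.cong)
    finally show ?case by (simp add: theta_series_nth)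
  qed
qed

text \<open>
  The infinite product of the \<open>1 - q\<^sup>k\<close> for \<open>k \<ge> 1\<close>, for \<open>q\<close> without constant term. Its coefficients
  are read off from finite products, which is correct because the coefficient of index \<open>i\<close> no longer
  changes after \<open>i\<close> factors.
\<close>
definition qpoch_inf :: "'a::comm_ring_1 fps \<Rightarrow> 'a fps" where
  "qpoch_inf q = Abs_fps (\<lambda>i. fps_nth (qpoch q i) i)"

lemma qpoch_inf_nth_0: "fps_nth (qpoch_inf q) 0 = 1"
  by (simp add: qpoch_inf_def)

lemma qpoch_tendsto:
  fixes q :: "'a::comm_ring_1 fps"
  assumes "fps_nth q 0 = 0"
  shows "qpoch q \<longlonglongrightarrow> qpoch_inf q"
proof (rule tendsto_fpsI)
  fix i
  have "fps_nth (qpoch q n) i = fps_nth (qpoch q i) i" if "n \<ge> i" for n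
    using that
  proof (induction n rule: dec_induct)
    case (step n)
    have "fps_nth (qpoch q n * q ^ Suc n) i = 0"
      unfolding fps_mult_nth
      by (rule sum.neutral) (use step startsby_zero_power_prefix[OF assms, of "Suc n"] in auto)
    then show ?case using step by (simp add: algebra_simps)
  qed auto
  then show "\<forall>\<^sub>F n in sequentially. fps_nth (qpoch q n) i = fps_nth (qpoch_inf q) i"
    unfolding eventually_sequentially qpoch_inf_def fps_nth_Abs_fps by blast
qed

text \<open>
  Central Gaussian binomials tend to the reciprocal of the infinite product: multiplying by
  \<open>qpoch q l * qpoch q r\<close> turns them into \<open>qpoch q (l + r)\<close>, and all of these products have the same
  limit.
\<close>
lemma qbin_times_qpoch_tendsto:
  fixes q :: "'a::comm_ring_1 fps"
  assumes "fps_nth q 0 = 0"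
  shows "(\<lambda>n. qbin q (int n - j) (int n + int s + j) * qpoch q n) \<longlonglongrightarrow> 1"
proof (rule tendsto_fps_cancel)
  let ?l = "\<lambda>n. nat (int n - j)" and ?r = "\<lambda>n. nat (int n + int s + j)"
  have lim: "filterlim ?l sequentially sequentially" "filterlim ?r sequentially sequentially"
    "filterlim (\<lambda>n. ?l n + ?r n) sequentially sequentially"
    unfolding filterlim_at_top eventually_sequentially
  proof safe
    fix Z
    show "\<exists>N. \<forall>n\<ge>N. Z \<le> ?l n" by (rule exI[of _ "Z + nat \<bar>j\<bar>"]) auto
    show "\<exists>N. \<forall>n\<ge>N. Z \<le> ?r n" by (rule exI[of _ "Z + nat \<bar>j\<bar>"]) auto
    show "\<exists>N. \<forall>n\<ge>N. Z \<le> ?l n + ?r n" by (rule exI[of _ "Z + nat \<bar>j\<bar>"]) auto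
  qed
  note P = qpoch_tendsto[OF assms]
  show "(\<lambda>n. qpoch q (?l n) * qpoch q (?r n)) \<longlonglongrightarrow> qpoch_inf q * qpoch_inf q"
    by (intro tendsto_fps_mult filterlim_compose[OF P] lim)
  have "(\<lambda>n. qpoch q (?l n + ?r n) * qpoch q n) \<longlonglongrightarrow> qpoch_inf q * qpoch_inf q"
    by (intro tendsto_fps_mult filterlim_compose[OF P] lim P)
  moreover have "\<forall>\<^sub>F n in sequentially. qpoch q (?l n + ?r n) * qpoch q n
      = qpoch q (?l n) * qpoch q (?r n) * (qbin q (int n - j) (int n + int s + j) * qpoch q n)"
    unfolding eventually_sequentially
  proof (intro exI[of _ "nat \<bar>j\<bar>"] allI impI)
    fix n assume "n \<ge> nat \<bar>j\<bar>"
    then have "qbin q (int n - j) (int n + int s + j) = qbinom q (?l n) (?r n)"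
      unfolding qbin_def by (subst if_not_P) (linarith | rule refl)+
    then show "qpoch q (?l n + ?r n) * qpoch q n
      = qpoch q (?l n) * qpoch q (?r n) * (qbin q (int n - j) (int n + int s + j) * qpoch q n)"
      by (simp add: qbinom_times_qpoch[symmetric] mult_ac)
  qed
  ultimately show "(\<lambda>n. qpoch q (?l n) * qpoch q (?r n) *
      (qbin q (int n - j) (int n + int s + j) * qpoch q n)) \<longlonglongrightarrow> qpoch_inf q * qpoch_inf q * 1"
    by (simp add: filterlim_cong)
qed (simp add: qpoch_inf_nth_0)

text \<open>
  The limit of \<open>finite_theta_product\<close>. After multiplication by \<open>qpoch q n\<close> the binomial coefficients
  disappear and the bare theta series remains.
\<close>
lemma theta_product_tendsto:
  fixes q :: "int fps" and lam :: "nat \<Rightarrow> int fps" and s :: nat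
  assumes q: "fps_nth q 0 = 0" and fin: "\<And>N. finite {j. e j = N}"
    and t: "\<And>j. t j = fps_const (w j) * fps_X ^ e j"
    and rec: "\<And>n i. - int n - int s \<le> i \<Longrightarrow> i \<le> int n \<Longrightarrow>
    q ^ nat (int n - i) * t (i + 1) + q ^ nat (int n + int s + i) * t (i - 1) = - (lam n * t i)"
  shows "(\<lambda>n. (\<Sum>j\<in>{- int s..0}. qbin q (- j) (int s + j) * t j)
     * (\<Prod>k<n. 1 + q ^ (2 * k + s + 1) - lam k) * qpoch q n) \<longlonglongrightarrow> theta_series w e"
proof -
  have "(\<lambda>n. \<Sum>j\<in>{- int n - int s..int n}. qbin q (int n - j) (int n + int s + j) * qpoch q n
      * (fps_const (w j) * fps_X ^ e j)) \<longlonglongrightarrow> theta_series w e"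
  proof (rule tendsto_theta_series[OF fin])
    show "\<forall>\<^sub>F n in sequentially. j \<in> {- int n - int s..int n}" for j
      unfolding eventually_sequentially by (rule exI[of _ "nat \<bar>j\<bar>"]) auto
  qed (use qbin_times_qpoch_tendsto[OF q] in auto)
  also have "(\<lambda>n. \<Sum>j\<in>{- int n - int s..int n}. qbin q (int n - j) (int n + int s + j) * qpoch q n
      * (fps_const (w j) * fps_X ^ e j))
    = (\<lambda>n. (\<Sum>j\<in>{- int n - int s..int n}. qbin q (int n - j) (int n + int s + j) * t j) * qpoch q n)"
    unfolding t sum_distrib_right by (simp add: mult_ac)
  moreover have "(\<Sum>j\<in>{- int n - int s..int n}. qbin q (int n - j) (int n + int s + j) * t j)
    = (\<Sum>j\<in>{- int s..0}. qbin q (- j) (int s + j) * t j) * (\<Prod>k<n. 1 + q ^ (2 * k + s + 1) - lam k)" for n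
    by (rule finite_theta_product) (rule rec)
  ultimately show ?thesis by simp
qed

section \<open>The triple product and Jacobi's identity for the cube\<close>

text \<open>
  The triangular numbers, continued to all integers so that theta series can be summed over
  \<open>j\<close> of either sign.
\<close>
definition tri :: "int \<Rightarrow> nat" where
  "tri j = nat (j * (j + 1) div 2)"

lemma int_tri: "2 * int (tri j) = j * (j + 1)"
proof -
  have "j * (j + 1) \<ge> 0"
    by (cases "j \<ge> 0") (auto simp: zero_le_mult_iff)
  moreover have "2 * (j * (j + 1) div 2) = j * (j + 1)" by simp
  ultimately show ?thesis by (simp add: tri_def)
qed

lemma tri_add_1: "int (tri (i + 1)) = int (tri i) + i + 1"
  using int_tri[of i] int_tri[of "i + 1"] by (simp add: algebra_simps)

lemma tri_diff_1: "int (tri (i - 1)) = int (tri i) - i"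
  using tri_add_1[of "i - 1"] by simp

lemma abs_le_tri: "nat \<bar>j\<bar> \<le> Suc (tri j)"
proof -
  have "2 * \<bar>j\<bar> \<le> 2 * (int (tri j) + 1)"
  proof (cases "j \<ge> 0")
    case True
    have "0 \<le> (j - 1) * j" using True by (cases "j = 0") auto
    then show ?thesis using int_tri[of j] True by (simp add: algebra_simps)
  next
    case False
    have "0 \<le> (j + 1) * (j + 2)" using False by (cases "j = -1") (auto simp: zero_le_mult_iff)
    then show ?thesis using int_tri[of j] False by (simp add: algebra_simps)
  qed
  then show ?thesis by (simp add: nat_le_iff)
qed

lemma finite_tri_fibre:
  assumes "\<And>j. tri j \<le> e j"
  shows "finite {j. e j = N}"
proof (rule finite_subset)
  show "{j. e j = N} \<subseteq> {- int (Suc N)..int (Suc N)}"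
  proof
    fix j assume "j \<in> {j. e j = N}"
    then have "nat \<bar>j\<bar> \<le> Suc N" using assms[of j] abs_le_tri[of j] by auto
    then show "j \<in> {- int (Suc N)..int (Suc N)}" by auto
  qed
qed simp

definition psgn :: "int \<Rightarrow> int" where
  "psgn j = (if even j then 1 else -1)"

lemma psgn_add_1: "psgn (i + 1) = - psgn i"
  and psgn_diff_1: "psgn (i - 1) = - psgn i"
  by (auto simp: psgn_def)

lemma psgn_add: "psgn (i + j) = psgn i * psgn j"
  by (auto simp: psgn_def)

text \<open>
  Jacobi's triple product for \<open>z = -X\<^sup>a\<close> and nome \<open>q = X\<^sup>a\<^sup>+\<^sup>b\<close>. The factors belonging to \<open>z\<close> and
  \<open>q/z\<close> have the exponents \<open>a\<close> and \<open>b\<close> modulo \<open>a + b\<close>, so no negative power occurs.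
\<close>
lemma triple_product_tendsto:
  assumes a: "a > 0" and b: "b > 0"
  shows "(\<lambda>n. (\<Prod>k<n. (1 - fps_X ^ (a + (a + b) * k)) * (1 - fps_X ^ (b + (a + b) * k)))
      * qpoch (fps_X ^ (a + b)) n) \<longlonglongrightarrow> theta_series psgn (\<lambda>j. a * tri j + b * tri (j - 1))"
proof -
  define q :: "int fps" where "q = fps_X ^ (a + b)"
  define e where "e = (\<lambda>j. a * tri j + b * tri (j - 1))"
  define t where "t = (\<lambda>j. fps_const (psgn j) * fps_X ^ e j :: int fps)"
  define lam where "lam = (\<lambda>n. (fps_X ^ a + fps_X ^ b) * q ^ n)"
  have q0: "fps_nth q 0 = 0" using a by (simp add: q_def)
  have "tri j \<le> e j" for j
    using a by (simp add: e_def trans_le_add1)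
  note fin = finite_tri_fibre[of e, OF this]
  have rec: "q ^ nat (int n - i) * t (i + 1) + q ^ nat (int n + int 0 + i) * t (i - 1) = - (lam n * t i)"
    if i: "- int n - int 0 \<le> i" "i \<le> int n" for n i
  proof -
    define l r where "l = nat (int n - i)" and "r = nat (int n + i)"
    have "(a + b) * l + e (i + 1) = a + (a + b) * n + e i"
    proof -
      have "int (e (i + 1)) = int a * (int (tri i) + i + 1) + int b * int (tri i)"
        by (simp add: e_def tri_add_1)
      then have "int ((a + b) * l + e (i + 1)) = int (a + (a + b) * n + e i)"
        using i by (simp add: fun_cong[OF e_def, of i] l_def tri_diff_1 algebra_simps)
      then show ?thesis by (simp only: of_nat_eq_iff)
    qed
    then have 1: "q ^ l * fps_X ^ e (i + 1) = fps_X ^ a * q ^ n * fps_X ^ e i"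
      by (simp add: q_def flip: power_mult power_add)
    have "(a + b) * r + e (i - 1) = b + (a + b) * n + e i"
    proof -
      have "int (tri (i - 1 - 1)) = int (tri i) - 2 * i + 1"
        by (simp only: tri_diff_1)
      then have "int (e (i - 1)) = int a * (int (tri i) - i) + int b * (int (tri i) - 2 * i + 1)"
        by (simp add: e_def tri_diff_1)
      then have "int ((a + b) * r + e (i - 1)) = int (b + (a + b) * n + e i)"
        using i by (simp add: fun_cong[OF e_def, of i] r_def tri_diff_1 algebra_simps)
      then show ?thesis by (simp only: of_nat_eq_iff)
    qed
    then have 2: "q ^ r * fps_X ^ e (i - 1) = fps_X ^ b * q ^ n * fps_X ^ e i"
      by (simp add: q_def flip: power_mult power_add)
    have "q ^ l * t (i + 1) + q ^ r * t (i - 1)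
       = - fps_const (psgn i) * (q ^ l * fps_X ^ e (i + 1) + q ^ r * fps_X ^ e (i - 1))"
      unfolding t_def psgn_add_1 psgn_diff_1 fps_const_neg[symmetric] by algebra
    also have "\<dots> = - (lam n * t i)"
      unfolding 1 2 lam_def t_def by algebra
    finally show ?thesis by (simp add: l_def r_def)
  qed
  have prod: "1 + q ^ (2 * k + 0 + 1) - lam k
      = (1 - fps_X ^ (a + (a + b) * k)) * (1 - fps_X ^ (b + (a + b) * k))" for k
    by (simp add: lam_def q_def algebra_simps power_add power_mult power2_eq_square mult_2)
  have "(\<Sum>j\<in>{- int 0..0}. qbin q (- j) (int 0 + j) * t j) = 1"
    by (simp add: qbin_def t_def psgn_def e_def tri_def)
  with theta_product_tendsto[OF q0 fin t_def[THEN fun_cong] rec] show ?thesis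
    unfolding prod by (simp add: q_def e_def)
qed

text \<open>
  With \<open>s = 1\<close> and weights linear in \<open>j\<close>, the neighbours contribute \<open>(2i + 3) + (2i - 1) = 2(2i + 1)\<close>,
  which makes the growth factor a perfect square \<open>(1 - u\<^sup>n\<^sup>+\<^sup>1)\<^sup>2\<close>. The third factor of the cube
  comes from the passage to the limit. Summing over all integers counts each term of the classical
  one-sided series twice, for \<open>j\<close> and \<open>-1 - j\<close>, whence the factor \<open>2\<close>. The sign \<open>\<epsilon>\<close> is
  there because both \<open>X\<^sup>4\<close> and \<open>-X\<close> are substituted later.
\<close>
lemma jacobi_cube:
  fixes \<epsilon> :: int
  assumes \<epsilon>: "\<epsilon>\<^sup>2 = 1" and m: "m > 0"
  shows "2 * qpoch_inf (fps_const \<epsilon> * fps_X ^ m) ^ 3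
    = theta_series (\<lambda>j. psgn j * (2 * j + 1) * \<epsilon> ^ tri j) (\<lambda>j. m * tri j)"
proof -
  define u :: "int fps" where "u = fps_const \<epsilon> * fps_X ^ m"
  define t where "t = (\<lambda>j. fps_const (psgn j * (2 * j + 1)) * u ^ tri j)"
  define lam where "lam = (\<lambda>n. 2 * u ^ (n + 1))"
  have u0: "fps_nth u 0 = 0" using m by (simp add: u_def)
  have "tri j \<le> m * tri j" for j using m by simp
  note fin = finite_tri_fibre[OF this]
  have t: "t j = fps_const (psgn j * (2 * j + 1) * \<epsilon> ^ tri j) * fps_X ^ (m * tri j)" for j
    by (simp add: t_def u_def power_mult_distrib fps_const_power power_mult mult.assoc flip: fps_const_mult)
  have rec: "u ^ nat (int n - i) * t (i + 1) + u ^ nat (int n + int 1 + i) * t (i - 1) = - (lam n * t i)"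
    if i: "- int n - int 1 \<le> i" "i \<le> int n" for n i
  proof -
    have "int (nat (int n - i) + tri (i + 1)) = int (n + 1 + tri i)"
      using i by (simp add: tri_add_1)
    then have 1: "u ^ nat (int n - i) * u ^ tri (i + 1) = u ^ (n + 1) * u ^ tri i"
      by (simp only: of_nat_eq_iff flip: power_add)
    have "int (nat (int n + int 1 + i) + tri (i - 1)) = int (n + 1 + tri i)"
      using i by (simp add: tri_diff_1)
    then have 2: "u ^ nat (int n + int 1 + i) * u ^ tri (i - 1) = u ^ (n + 1) * u ^ tri i"
      by (simp only: of_nat_eq_iff flip: power_add)
    have "u ^ nat (int n - i) * t (i + 1) + u ^ nat (int n + int 1 + i) * t (i - 1)
      = fps_const (- psgn i * (2 * (i + 1) + 1)) * (u ^ nat (int n - i) * u ^ tri (i + 1))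
       + fps_const (- psgn i * (2 * (i - 1) + 1)) * (u ^ nat (int n + int 1 + i) * u ^ tri (i - 1))"
      by (simp only: t_def psgn_add_1 psgn_diff_1 mult_ac)
    also have "\<dots> = (fps_const (- psgn i * (2 * (i + 1) + 1)) + fps_const (- psgn i * (2 * (i - 1) + 1)))
        * (u ^ (n + 1) * u ^ tri i)"
      unfolding 1 2 by (simp only: distrib_right)
    also have "\<dots> = fps_const (- 2 * (psgn i * (2 * i + 1))) * (u ^ (n + 1) * u ^ tri i)"
      by (simp add: algebra_simps)
    also have "fps_const (- 2 * (psgn i * (2 * i + 1))) = - 2 * fps_const (psgn i * (2 * i + 1))"
      by (simp only: fps_const_mult fps_const_neg numeral_fps_const)
    also have "\<dots> * (u ^ (n + 1) * u ^ tri i) = - (lam n * t i)"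
      by (simp add: lam_def t_def mult_ac)
    finally show ?thesis .
  qed
  have prod: "1 + u ^ (2 * k + 1 + 1) - lam k = (1 - u ^ Suc k) ^ 2" for k
  proof -
    have "2 * k + 1 + 1 = Suc k + Suc k" by simp
    then have p: "u ^ (2 * k + 1 + 1) = u ^ Suc k * u ^ Suc k" by (metis power_add)
    have l: "lam k = 2 * u ^ Suc k" by (simp add: lam_def)
    have "1 + v * v - 2 * v = (1 - v)\<^sup>2" for v :: "int fps" by algebra
    then show ?thesis unfolding p l .
  qed
  have "{- int 1..0} = {-1, 0 :: int}" by auto
  then have "(\<Sum>j\<in>{- int 1..0}. qbin u (- j) (int 1 + j) * t j) = 2"
    by (simp add: qbin_def t_def psgn_def tri_def)
  with theta_product_tendsto[OF u0 fin t rec]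
  have "(\<lambda>n. 2 * qpoch u n ^ 2 * qpoch u n)
      \<longlonglongrightarrow> theta_series (\<lambda>j. psgn j * (2 * j + 1) * \<epsilon> ^ tri j) (\<lambda>j. m * tri j)"
    unfolding prod prod_power_distrib qpoch_def by simp
  moreover have "(\<lambda>n. 2 * qpoch u n ^ 2 * qpoch u n) \<longlonglongrightarrow> 2 * qpoch_inf u ^ 2 * qpoch_inf u"
    by (intro tendsto_fps_mult tendsto_fps_power qpoch_tendsto u0 tendsto_const)
  ultimately have "2 * qpoch_inf u ^ 2 * qpoch_inf u
      = theta_series (\<lambda>j. psgn j * (2 * j + 1) * \<epsilon> ^ tri j) (\<lambda>j. m * tri j)"
    by (rule LIMSEQ_unique[THEN sym])
  then show ?thesis
    by (simp add: u_def power3_eq_cube power2_eq_square mult.assoc)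
qed

lemma qpoch_bisect: "qpoch q (2 * n) = (\<Prod>k<n. 1 - q ^ (2 * k + 1)) * qpoch (q\<^sup>2) n"
proof (induction n)
  case (Suc n)
  have e: "2 * Suc n = Suc (Suc (2 * n))" "2 * n + 1 = Suc (2 * n)" by simp_all
  then have p: "(q\<^sup>2) ^ Suc n = q ^ Suc (Suc (2 * n))" by (metis power_mult)
  show ?case
    unfolding e(1) qpoch_Suc Suc.IH prod.lessThan_Suc p e(2) by (simp only: mult_ac)
qed simp

lemma qpoch_trisect:
  "qpoch q (3 * n) = (\<Prod>k<n. (1 - q ^ (3 * k + 1)) * (1 - q ^ (3 * k + 2))) * qpoch (q ^ 3) n"
proof (induction n)
  case (Suc n)
  have e: "3 * Suc n = Suc (Suc (Suc (3 * n)))" "3 * n + 1 = Suc (3 * n)" "3 * n + 2 = Suc (Suc (3 * n))"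
    by simp_all
  then have p: "(q ^ 3) ^ Suc n = q ^ Suc (Suc (Suc (3 * n)))" by (metis power_mult)
  show ?case
    unfolding e(1) qpoch_Suc Suc.IH prod.lessThan_Suc p e(2,3) by (simp only: mult_ac)
qed simp

text \<open>
  The limit of this identity expresses the product at \<open>-q\<close> through products at \<open>q\<close>, \<open>q\<^sup>2\<close>
  and \<open>q\<^sup>4\<close>. Even factors coincide for \<open>q\<close> and \<open>-q\<close>, odd ones combine to \<open>1 - q\<^sup>2\<^sup>k\<close> with odd \<open>k\<close>, and
  the third product on the left supplies those with even \<open>k\<close>.
\<close>
lemma qpoch_sign_change:
  "qpoch q (2 * n) * qpoch (- q) (2 * n) * qpoch (q ^ 4) n = qpoch (q\<^sup>2) n ^ 2 * qpoch (q\<^sup>2) (2 * n)"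
proof (induction n)
  case (Suc n)
  define x where "x = q ^ Suc (2 * n)"
  define y where "y = q ^ Suc (Suc (2 * n))"
  have e: "2 * Suc n = Suc (Suc (2 * n))" by simp
  have 1: "(- q) ^ Suc (2 * n) = - x" "(- q) ^ Suc (Suc (2 * n)) = y"
    by (simp_all add: x_def y_def power_mult)
  have 2: "(q ^ 4) ^ Suc n = y\<^sup>2" "(q\<^sup>2) ^ Suc n = y" "(q\<^sup>2) ^ Suc (2 * n) = x\<^sup>2" "(q\<^sup>2) ^ Suc (Suc (2 * n)) = y\<^sup>2"
    unfolding x_def y_def power_mult[symmetric] by (rule arg_cong[where f = "power q"], simp)+
  have "qpoch q (2 * Suc n) * qpoch (- q) (2 * Suc n) * qpoch (q ^ 4) (Suc n)
      = (qpoch q (2 * n) * qpoch (- q) (2 * n) * qpoch (q ^ 4) n)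
        * ((1 - x) * (1 - y) * (1 + x) * (1 - y) * (1 - y\<^sup>2))"
    unfolding e qpoch_Suc 1 2 x_def[symmetric] y_def[symmetric] by (simp add: mult_ac)
  also have "\<dots> = qpoch (q\<^sup>2) n ^ 2 * qpoch (q\<^sup>2) (2 * n) * ((1 - x) * (1 - y) * (1 + x) * (1 - y) * (1 - y\<^sup>2))"
    unfolding Suc.IH ..
  also have "\<dots> = (qpoch (q\<^sup>2) n * (1 - y)) ^ 2 * (qpoch (q\<^sup>2) (2 * n) * (1 - x\<^sup>2) * (1 - y\<^sup>2))"
  proof -
    have "(1 - x) * (1 + x) = 1 - x\<^sup>2"
      by (simp add: algebra_simps power2_eq_square)
    moreover have "(1 - x) * (1 - y) * (1 + x) * (1 - y) * (1 - y\<^sup>2)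
        = ((1 - x) * (1 + x)) * (1 - y)\<^sup>2 * (1 - y\<^sup>2)"
      by (simp only: power2_eq_square mult_ac)
    ultimately show ?thesis by (simp only: power_mult_distrib mult_ac)
  qed
  finally show ?case
    unfolding e qpoch_Suc 2 .
qed simp

section \<open>A theta series with linear weights\<close>

lemma sum_involution_neg:
  fixes f :: "'i \<Rightarrow> int"
  assumes "\<And>x. x \<in> A \<Longrightarrow> \<phi> x \<in> A" "\<And>x. x \<in> A \<Longrightarrow> \<phi> (\<phi> x) = x" "\<And>x. x \<in> A \<Longrightarrow> f (\<phi> x) = - f x"
  shows "sum f A = 0"
proof -
  have "sum f A = (\<Sum>x\<in>A. - f x)"
    by (rule sum.reindex_bij_witness[of _ \<phi> \<phi>]) (use assms in auto)
  then show ?thesis by (simp add: sum_negf)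
qed

text \<open>
  With \<open>y = 2j + 1\<close> the form on the left is \<open>i\<^sup>2 + (y\<^sup>2 - 1)/2\<close>, and \<open>y\<^sup>2 + 2i\<^sup>2\<close> is a norm from
  \<open>\<int>[\<surd>(-2)]\<close>. Multiplying \<open>y + i\<surd>(-2)\<close> by \<open>1 + \<surd>(-2)\<close>, of norm \<open>3\<close>, produces the coordinates
  \<open>u = y - 2i\<close> and \<open>v = y + i\<close>, in which the form becomes the one on the right. The weight \<open>y\<close> may be
  replaced by \<open>v\<close>, since \<open>i\<close> alone sums to \<open>0\<close> by symmetry. Then the pairs are sorted by
  \<open>v\<close> modulo \<open>3\<close>. For \<open>v\<close> divisible by \<open>3\<close> the reflection \<open>u \<mapsto> -u\<close> is available and cancels all
  terms; the other two classes are exchanged by negation, and \<open>v = 3n + 1\<close>, \<open>u = 1 - 6k\<close>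
  parametrises one of them.
\<close>
lemma quadratic_form_sum:
  fixes N :: int
  defines "A \<equiv> {(i, j). i\<^sup>2 + 2 * (j * (j + 1)) = N}"
    and "C \<equiv> {(k, n). 6 * k\<^sup>2 - 2 * k + 3 * n\<^sup>2 + 2 * n = N}"
  assumes fin: "finite A"
  shows "(\<Sum>(i, j)\<in>A. psgn i * (psgn j * (2 * j + 1))) = 2 * (\<Sum>(k, n)\<in>C. psgn k * (3 * n + 1))"
proof -
  define f where "f = (\<lambda>(i, j). psgn (i + j) * (i + 2 * j + 1))"
  define B where "B = (\<lambda>r. {(i, j). (i, j) \<in> A \<and> (i + 2 * j + 1) mod 3 = r})"
  have "(\<Sum>(i, j)\<in>A. psgn (i + j) * i) = 0"
    by (rule sum_involution_neg[of _ "\<lambda>(i, j). (- i, j)"]) (auto simp: A_def psgn_def)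
  moreover have "(\<Sum>(i, j)\<in>A. psgn i * (psgn j * (2 * j + 1))) + (\<Sum>(i, j)\<in>A. psgn (i + j) * i) = sum f A"
    unfolding sum.distrib[symmetric] f_def by (rule sum.cong) (auto simp: psgn_add algebra_simps)
  moreover have "sum f A = sum f (B 0) + sum f (B 1) + sum f (B 2)"
  proof -
    have "(i + 2 * j + 1) mod 3 = 0 \<or> (i + 2 * j + 1) mod 3 = 1 \<or> (i + 2 * j + 1) mod 3 = 2" for i j :: int
      by presburger
    then have "A = B 0 \<union> B 1 \<union> B 2" by (auto simp: B_def)
    moreover have "finite (B r)" for r
      by (rule finite_subset[OF _ fin]) (auto simp: B_def)
    moreover have "B 0 \<inter> B 1 = {}" "(B 0 \<union> B 1) \<inter> B 2 = {}" by (auto simp: B_def)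
    ultimately show ?thesis by (simp add: sum.union_disjoint)
  qed
  moreover have "sum f (B 0) = 0"
  proof (rule sum_involution_neg)
    \<comment> \<open>\<open>w\<close> is \<open>u / 3\<close>, and the reflection \<open>u \<mapsto> -u\<close> with \<open>v\<close> fixed moves \<open>(i, j)\<close> by \<open>(2w, -w)\<close>.
        It changes the sign because \<open>u\<close>, hence \<open>w\<close>, is odd.\<close>
    define w where "w = (\<lambda>(i, j). (2 * j + 1 - 2 * i) div 3 :: int)"
    define \<phi> where "\<phi> = (\<lambda>(i, j). (i + 2 * w (i, j), j - w (i, j)))"
    fix x assume x: "x \<in> B 0"
    obtain i j where ij: "x = (i, j)" by (cases x)
    have "(i + 2 * j + 1) mod 3 = 0" using x by (simp add: B_def ij)
    then have w: "3 * w (i, j) = 2 * j + 1 - 2 * i" unfolding w_def prod.case by presburger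
    have \<phi>: "\<phi> x = (i + 2 * w (i, j), j - w (i, j))" by (simp add: \<phi>_def ij)
    have w': "w (i + 2 * w (i, j), j - w (i, j)) = - w (i, j)"
    proof -
      have "2 * (j - v) + 1 - 2 * (i + 2 * v) = 3 * (- v)" if "3 * v = 2 * j + 1 - 2 * i" for v
        using that by (simp add: algebra_simps)
      from this[OF w] show ?thesis
        unfolding fun_cong[OF w_def, of "(i + 2 * w (i, j), j - w (i, j))"] prod.case
        by (simp only: nonzero_mult_div_cancel_left[of 3])
    qed
    have "odd (3 * w (i, j))" unfolding w by simp
    then have odd: "odd (w (i, j))" by simp
    show "\<phi> x \<in> B 0"
    proof -
      have "(i + 2 * w (i, j))\<^sup>2 + 2 * ((j - w (i, j)) * (j - w (i, j) + 1))
          = i\<^sup>2 + 2 * (j * (j + 1)) + 2 * w (i, j) * (3 * w (i, j) - (2 * j + 1 - 2 * i))"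
        by (simp add: algebra_simps power2_eq_square)
      moreover have "i + 2 * w (i, j) + 2 * (j - w (i, j)) + 1 = i + 2 * j + 1" by simp
      ultimately show ?thesis using x w unfolding \<phi> by (simp add: B_def A_def ij)
    qed
    show "\<phi> (\<phi> x) = x"
      unfolding \<phi> unfolding \<phi>_def prod.case w' by (simp add: ij)
    have "f (\<phi> x) = psgn (i + j + w (i, j)) * (i + 2 * j + 1)"
      unfolding \<phi> f_def by (simp add: algebra_simps)
    then show "f (\<phi> x) = - f x"
      using odd by (simp add: psgn_def ij f_def)
  qed
  moreover have "sum f (B 2) = sum f (B 1)"
  proof (rule sum.reindex_bij_witness[of _ "\<lambda>(i, j). (- i, - 1 - j)" "\<lambda>(i, j). (- i, - 1 - j)"])
    have neg: "(- i, - 1 - j) \<in> A \<longleftrightarrow> (i, j) \<in> A" for i j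
      by (simp add: A_def algebra_simps)
    have res: "(- i + 2 * (- 1 - j) + 1) mod 3 = 1 \<longleftrightarrow> (i + 2 * j + 1) mod 3 = 2"
      "(- i + 2 * (- 1 - j) + 1) mod 3 = 2 \<longleftrightarrow> (i + 2 * j + 1) mod 3 = 1" for i j :: int
      by presburger+
    have "(- i, - 1 - j) \<in> B 1 \<longleftrightarrow> (i, j) \<in> B 2" "(- i, - 1 - j) \<in> B 2 \<longleftrightarrow> (i, j) \<in> B 1" for i j
      by (simp_all only: B_def mem_Collect_eq prod.case neg res)
    then show "(case x of (i, j) \<Rightarrow> (- i, - 1 - j)) \<in> B 1" if "x \<in> B 2" for x
      using that by (cases x) (simp only: prod.case)
    show "(case x of (i, j) \<Rightarrow> (- i, - 1 - j)) \<in> B 2" if "x \<in> B 1" for x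
      using that \<open>\<And>i j. (- i, - 1 - j) \<in> B 2 \<longleftrightarrow> (i, j) \<in> B 1\<close> by (cases x) (simp only: prod.case)
    show "f (case x of (i, j) \<Rightarrow> (- i, - 1 - j)) = f x" if "x \<in> B 2" for x
      by (cases x) (auto simp: f_def psgn_def algebra_simps)
  qed auto
  moreover have "sum f (B 1) = (\<Sum>(k, n)\<in>C. psgn k * (3 * n + 1))"
  proof (rule sum.reindex_bij_witness[of _ "\<lambda>(k, n). (n + 2 * k, n - k)" "\<lambda>(i, j). ((i - j) div 3, j + (i - j) div 3)"])
    fix x assume x: "x \<in> B 1"
    obtain i j where ij: "x = (i, j)" by (cases x)
    have "(i + 2 * j + 1) mod 3 = 1" using x by (simp add: B_def ij)
    then have "3 * ((i - j) div 3) = i - j" by presburger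
    then obtain k where k: "i = j + 3 * k" by (metis diff_add_cancel add.commute)
    then have kd: "(i - j) div 3 = k" by simp
    show "(case case x of (i, j) \<Rightarrow> ((i - j) div 3, j + (i - j) div 3) of (k, n) \<Rightarrow> (n + 2 * k, n - k)) = x"
      by (simp add: ij k)
    show "(case x of (i, j) \<Rightarrow> ((i - j) div 3, j + (i - j) div 3)) \<in> C"
      using x by (simp add: ij k B_def A_def C_def algebra_simps power2_eq_square)
    show "(case case x of (i, j) \<Rightarrow> ((i - j) div 3, j + (i - j) div 3) of (k, n) \<Rightarrow> psgn k * (3 * n + 1)) = f x"
      by (simp add: ij k f_def psgn_def algebra_simps)
  next
    fix y assume y: "y \<in> C"
    obtain k n where kn: "y = (k, n)" by (cases y)
    show "(case case y of (k, n) \<Rightarrow> (n + 2 * k, n - k) of (i, j) \<Rightarrow> ((i - j) div 3, j + (i - j) div 3)) = y"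
      by (simp add: kn)
    have "n + 2 * k + 2 * (n - k) + 1 = 1 + 3 * n" by simp
    then have "(n + 2 * k + 2 * (n - k) + 1) mod 3 = 1" by (simp only: mod_mult_self2) simp
    then show "(case y of (k, n) \<Rightarrow> (n + 2 * k, n - k)) \<in> B 1"
      using y by (simp add: kn B_def A_def C_def algebra_simps power2_eq_square)
  qed
  ultimately show ?thesis by simp
qed

text \<open>
  Squares and (four times) generalised pentagonal numbers as exponents of triple products, and the
  other exponents that occur, as polynomials over the integers.
\<close>
lemma int_theta_exponents:
  "int (1 * tri i + 1 * tri (i - 1)) = i\<^sup>2"
  "int (4 * tri j) = 2 * (j * (j + 1))"
  "int (4 * tri k + 8 * tri (k - 1)) = 6 * k\<^sup>2 - 2 * k"
  "int (nat (3 * n\<^sup>2 + 2 * n)) = 3 * n\<^sup>2 + 2 * n"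
proof -
  show "int (1 * tri i + 1 * tri (i - 1)) = i\<^sup>2"
    using int_tri[of i] by (simp add: tri_diff_1 power2_eq_square algebra_simps)
  show "int (4 * tri j) = 2 * (j * (j + 1))" using int_tri[of j] by simp
  show "int (4 * tri k + 8 * tri (k - 1)) = 6 * k\<^sup>2 - 2 * k"
    using int_tri[of k] by (simp add: tri_diff_1 power2_eq_square algebra_simps)
  have "0 \<le> n * (3 * n + 2)" by (cases "n \<ge> 0") (auto simp: zero_le_mult_iff)
  then show "int (nat (3 * n\<^sup>2 + 2 * n)) = 3 * n\<^sup>2 + 2 * n"
    by (simp add: power2_eq_square algebra_simps)
qed

definition linear_theta :: "int fps" where
  "linear_theta = theta_series (\<lambda>n. 3 * n + 1) (\<lambda>n. nat (3 * n\<^sup>2 + 2 * n))"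

lemma finite_linear_theta_fibre: "finite {n. nat (3 * n\<^sup>2 + 2 * n) = N}"
proof (rule finite_tri_fibre)
  fix j :: int
  have "0 \<le> j * (5 * j + 3)" by (cases "j \<ge> 0") (auto simp: zero_le_mult_iff)
  then have "2 * int (tri j) \<le> 2 * int (nat (3 * j\<^sup>2 + 2 * j))"
    unfolding int_tri int_theta_exponents by (simp add: power2_eq_square algebra_simps)
  then have "int (tri j) \<le> int (nat (3 * j\<^sup>2 + 2 * j))" by linarith
  then show "tri j \<le> nat (3 * j\<^sup>2 + 2 * j)" by (simp only: of_nat_le_iff)
qed

text \<open>
  Multiplied by \<open>H = \<Prod>(1 - X\<^sup>4\<^sup>k)\<close>, both sides become binary theta series: on the left \<open>H\<close> is
  expanded by Euler's pentagonal number theorem, on the right \<open>H\<^sup>3\<close> by Jacobi's identity. Their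
  coefficients are the two sums of \<open>quadratic_form_sum\<close>.
\<close>
lemma linear_theta_times_qpoch_inf:
  "qpoch_inf (fps_X ^ 4) * linear_theta
     = theta_series psgn (\<lambda>i. 1 * tri i + 1 * tri (i - 1)) * qpoch_inf (fps_X ^ 4) ^ 3"
proof -
  define H :: "int fps" where "H = qpoch_inf (fps_X ^ 4)"
  define sq where "sq = (\<lambda>i. 1 * tri i + 1 * tri (i - 1))"
  define pent where "pent = (\<lambda>k. 4 * tri k + 8 * tri (k - 1))"
  have "(\<lambda>n. (\<Prod>k<n. (1 - fps_X ^ (4 + (4 + 8) * k)) * (1 - fps_X ^ (8 + (4 + 8) * k))) * qpoch (fps_X ^ (4 + 8)) n)
      \<longlonglongrightarrow> theta_series psgn pent"
    unfolding pent_def by (rule triple_product_tendsto) auto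
  also have "(\<lambda>n. (\<Prod>k<n. (1 - fps_X ^ (4 + (4 + 8) * k)) * (1 - fps_X ^ (8 + (4 + 8) * k))) * qpoch (fps_X ^ (4 + 8)) n)
    = (\<lambda>n. qpoch (fps_X ^ 4 :: int fps) (3 * n))"
  proof
    fix n
    have e: "4 + (4 + 8) * k = 4 * (3 * k + 1)" "8 + (4 + 8) * k = 4 * (3 * k + 2)" "4 + 8 = 4 * (3 :: nat)" for k :: nat
      by simp_all
    show "(\<Prod>k<n. (1 - fps_X ^ (4 + (4 + 8) * k)) * (1 - fps_X ^ (8 + (4 + 8) * k))) * qpoch (fps_X ^ (4 + 8)) n
        = qpoch (fps_X ^ 4 :: int fps) (3 * n)"
      unfolding qpoch_trisect e(1,2) unfolding e(3) power_mult ..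
  qed
  finally have 1: "(\<lambda>n. qpoch (fps_X ^ 4 :: int fps) (3 * n)) \<longlonglongrightarrow> theta_series psgn pent" .
  have "filterlim (\<lambda>n. 3 * n :: nat) sequentially sequentially"
    by (rule filterlim_subseq) (auto simp: strict_mono_def)
  then have "(\<lambda>n. qpoch (fps_X ^ 4 :: int fps) (3 * n)) \<longlonglongrightarrow> H"
    unfolding H_def by (rule filterlim_compose[OF qpoch_tendsto, rotated]) simp
  with 1 have pent: "H = theta_series psgn pent"
    by (rule LIMSEQ_unique[THEN sym])
  have cube: "2 * H ^ 3 = theta_series (\<lambda>j. psgn j * (2 * j + 1)) (\<lambda>j. 4 * tri j)"
    using jacobi_cube[of 1 4] by (simp add: H_def)
  have "tri i \<le> sq i" "tri i \<le> pent i" "tri i \<le> 4 * tri i" for i by (auto simp: sq_def pent_def)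
  note fins = this[THEN finite_tri_fibre]
  have "theta_series psgn sq * (2 * H ^ 3) = 2 * (H * linear_theta)"
  proof (rule fps_ext)
    fix N
    define A where "A = {(i, j). i\<^sup>2 + 2 * (j * (j + 1)) = int N}"
    define C where "C = {(k, n). 6 * k\<^sup>2 - 2 * k + 3 * n\<^sup>2 + 2 * n = int N}"
    have A: "{(i, j). sq i + 4 * tri j = N} = A"
    proof -
      have "sq i + 4 * tri j = N \<longleftrightarrow> int (sq i) + int (4 * tri j) = int N" for i j by linarith
      then show ?thesis unfolding A_def sq_def int_theta_exponents by simp
    qed
    have C: "{(k, n). pent k + nat (3 * n\<^sup>2 + 2 * n) = N} = C"
    proof -
      have "pent k + nat (3 * n\<^sup>2 + 2 * n) = N \<longleftrightarrow> int (pent k) + int (nat (3 * n\<^sup>2 + 2 * n)) = int N" for k n by linarith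
      then show ?thesis unfolding C_def pent_def int_theta_exponents by (simp add: algebra_simps)
    qed
    have "finite A" unfolding A[symmetric] by (rule theta_series_mult_nth(2)[OF fins(1) fins(3)])
    then have "(\<Sum>(i, j)\<in>A. psgn i * (psgn j * (2 * j + 1))) = 2 * (\<Sum>(k, n)\<in>C. psgn k * (3 * n + 1))"
      unfolding A_def C_def by (rule quadratic_form_sum)
    moreover have "fps_nth (theta_series psgn sq * (2 * H ^ 3)) N = (\<Sum>(i, j)\<in>A. psgn i * (psgn j * (2 * j + 1)))"
      unfolding cube A[symmetric] by (rule theta_series_mult_nth(1)[OF fins(1) fins(3)])
    moreover have "fps_nth (H * linear_theta) N = (\<Sum>(k, n)\<in>C. psgn k * (3 * n + 1))"
      unfolding pent linear_theta_def C[symmetric]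
      by (rule theta_series_mult_nth(1)[OF fins(2) finite_linear_theta_fibre])
    ultimately show "fps_nth (theta_series psgn sq * (2 * H ^ 3)) N = fps_nth (2 * (H * linear_theta)) N"
      by (simp add: numeral_fps_const)
  qed
  then have "2 * (H * linear_theta) = 2 * (theta_series psgn sq * H ^ 3)" by (simp add: mult_ac)
  then show ?thesis unfolding H_def sq_def by (simp del: mult_1)
qed

text \<open>
  The preceding lemma gives \<open>linear_theta = \<Phi> H\<^sup>2\<close>, where \<open>\<Phi> = \<Sum>(-1)\<^sup>i X\<^bsup>i\<^sup>2\<^esup>\<close>. The rest is
  bookkeeping with products: \<open>\<Phi> E = P\<^sup>2\<close> by the triple product and \<open>P G H = E\<^sup>3\<close> by
  \<open>qpoch_sign_change\<close>.
\<close>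
lemma linear_theta_product:
  "linear_theta * qpoch_inf (- fps_X) ^ 2 = qpoch_inf (fps_X\<^sup>2) ^ 5"
proof -
  define H P G E :: "int fps" where "H = qpoch_inf (fps_X ^ 4)" and "P = qpoch_inf fps_X"
    and "G = qpoch_inf (- fps_X)" and "E = qpoch_inf (fps_X\<^sup>2)"
  define \<Phi> where "\<Phi> = theta_series psgn (\<lambda>i. 1 * tri i + 1 * tri (i - 1))"
  have dbl: "filterlim (\<lambda>n. 2 * n :: nat) sequentially sequentially"
    by (rule filterlim_subseq) (auto simp: strict_mono_def)
  note lims = qpoch_tendsto filterlim_compose[OF qpoch_tendsto dbl]
  have nz: "H \<noteq> 0" "E \<noteq> 0"
    using qpoch_inf_nth_0 by (metis H_def E_def fps_zero_nth zero_neq_one)+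
  have "\<Phi> * E = P ^ 2"
  proof (rule LIMSEQ_unique)
    have "(\<lambda>n. (\<Prod>k<n. (1 - fps_X ^ (1 + (1 + 1) * k)) * (1 - fps_X ^ (1 + (1 + 1) * k))) * qpoch (fps_X ^ (1 + 1)) n)
        \<longlonglongrightarrow> \<Phi>"
      unfolding \<Phi>_def by (rule triple_product_tendsto) auto
    moreover have "qpoch (fps_X\<^sup>2) \<longlonglongrightarrow> E"
      unfolding E_def by (rule qpoch_tendsto) simp
    ultimately have "(\<lambda>n. (\<Prod>k<n. (1 - fps_X ^ (1 + (1 + 1) * k)) * (1 - fps_X ^ (1 + (1 + 1) * k))) * qpoch (fps_X ^ (1 + 1)) n * qpoch (fps_X\<^sup>2) n)
        \<longlonglongrightarrow> \<Phi> * E"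
      by (rule tendsto_fps_mult)
    also have "(\<lambda>n. (\<Prod>k<n. (1 - fps_X ^ (1 + (1 + 1) * k)) * (1 - fps_X ^ (1 + (1 + 1) * k))) * qpoch (fps_X ^ (1 + 1)) n * qpoch (fps_X\<^sup>2) n)
      = (\<lambda>n. qpoch (fps_X :: int fps) (2 * n) ^ 2)"
    proof
      fix n
      have e: "1 + (1 + 1) * k = 2 * k + 1" "1 + 1 = (2 :: nat)" for k :: nat by simp_all
      show "(\<Prod>k<n. (1 - fps_X ^ (1 + (1 + 1) * k)) * (1 - fps_X ^ (1 + (1 + 1) * k))) * qpoch (fps_X ^ (1 + 1)) n * qpoch (fps_X\<^sup>2) n
        = qpoch (fps_X :: int fps) (2 * n) ^ 2"
        unfolding qpoch_bisect e(1) unfolding e(2) prod.distrib power_mult_distrib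
        by (simp only: power2_eq_square[of "prod _ _"] power2_eq_square[of "qpoch _ _"] mult_ac)
    qed
    finally show "(\<lambda>n. qpoch (fps_X :: int fps) (2 * n) ^ 2) \<longlonglongrightarrow> \<Phi> * E" .
    show "(\<lambda>n. qpoch (fps_X :: int fps) (2 * n) ^ 2) \<longlonglongrightarrow> P ^ 2"
      unfolding P_def by (intro tendsto_fps_power lims) simp
  qed
  moreover have "P * G * H = E ^ 2 * E"
  proof (rule LIMSEQ_unique)
    show "(\<lambda>n. qpoch fps_X (2 * n) * qpoch (- fps_X) (2 * n) * qpoch (fps_X ^ 4) n) \<longlonglongrightarrow> P * G * H"
      unfolding P_def G_def H_def by (intro tendsto_fps_mult lims) simp_all
    show "(\<lambda>n. qpoch fps_X (2 * n) * qpoch (- fps_X) (2 * n) * qpoch (fps_X ^ 4) n) \<longlonglongrightarrow> E ^ 2 * E"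
      unfolding qpoch_sign_change E_def by (intro tendsto_fps_mult tendsto_fps_power lims) simp_all
  qed
  moreover have "H * linear_theta = H * (\<Phi> * H\<^sup>2)"
    using linear_theta_times_qpoch_inf by (simp add: H_def \<Phi>_def power2_eq_square power3_eq_cube mult_ac)
  then have "linear_theta = \<Phi> * H\<^sup>2" using nz by simp
  ultimately have "E * (linear_theta * G\<^sup>2) = E * E ^ 5" by algebra
  then show ?thesis using nz by (simp add: E_def G_def)
qed

section \<open>The generating function of the difference of sums of parts\<close>

definition bounded_parts :: "nat \<Rightarrow> nat \<Rightarrow> nat multiset set" where
  "bounded_parts m n = {P \<in> partitions_no_rep_odd n. \<forall>p\<in>#P. p \<le> m}"

lemma finite_bounded_parts [simp]: "finite (bounded_parts m n)"
  by (simp add: bounded_parts_def finite_partitions_no_rep_odd)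

lemma bounded_parts_0: "bounded_parts 0 n = (if n = 0 then {{#}} else {})"
proof -
  have "P = {#}" if "P \<in> bounded_parts 0 n" for P
  proof (rule ccontr)
    assume "P \<noteq> {#}"
    then obtain p where "p \<in># P" by blast
    then show False using that by (auto simp: bounded_parts_def partitions_no_rep_odd_def partitions_def)
  qed
  moreover have "{#} \<in> bounded_parts 0 n \<longleftrightarrow> n = 0"
    by (auto simp: bounded_parts_def partitions_no_rep_odd_def partitions_def)
  ultimately show ?thesis by auto
qed

lemma bounded_parts_all: "bounded_parts m n = partitions_no_rep_odd n" if "n \<le> m"
  using that by (auto simp: bounded_parts_def partitions_no_rep_odd_def partitions_def
      dest!: multi_member_split)

text \<open>
  Remove one copy of the new largest part \<open>k\<close>, if there is one. An even part may occur again in the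
  rest, an odd part may not.
\<close>
lemma bounded_parts_Suc:
  fixes m n
  defines "k \<equiv> Suc m"
  shows "bounded_parts k n = bounded_parts m n \<union>
    (if k \<le> n then add_mset k ` bounded_parts (if even k then k else m) (n - k) else {})" (is "?L = ?M \<union> ?R")
proof (intro equalityI subsetI)
  fix P assume P: "P \<in> ?L"
  show "P \<in> ?M \<union> ?R"
  proof (cases "k \<in># P")
    case False
    then have "\<forall>p\<in>#P. p \<le> m"
      using P by (auto simp: bounded_parts_def k_def le_Suc_eq)
    then show ?thesis using P by (auto simp: bounded_parts_def)
  next
    case True
    then obtain Q where Q: "P = add_mset k Q" by (auto dest: multi_member_split)
    have "count Q j \<le> 1" if "odd j" for j
    proof -
      have "count Q j \<le> count P j" unfolding Q by simp
      also have "\<dots> \<le> 1" using P that by (simp add: bounded_parts_def partitions_no_rep_odd_def)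
      finally show ?thesis .
    qed
    then have "k \<le> n" and "Q \<in> bounded_parts k (n - k)"
      using P unfolding Q by (auto simp: bounded_parts_def partitions_no_rep_odd_def partitions_def)
    moreover have "k \<notin># Q" if "odd k"
      using P that unfolding Q by (auto simp: bounded_parts_def partitions_no_rep_odd_def not_in_iff)
    then have "\<forall>p\<in>#Q. p \<le> m" if "odd k"
      using that \<open>Q \<in> bounded_parts k (n - k)\<close> by (auto simp: bounded_parts_def k_def le_Suc_eq)
    ultimately show ?thesis unfolding Q by (auto simp: bounded_parts_def)
  qed
next
  fix P assume "P \<in> ?M \<union> ?R"
  then show "P \<in> ?L"
  proof
    assume "P \<in> ?M" then show ?thesis by (auto simp: bounded_parts_def k_def)
  next
    assume "P \<in> ?R"
    then obtain Q where "k \<le> n" and P: "P = add_mset k Q" and Q: "Q \<in> bounded_parts (if even k then k else m) (n - k)"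
      by (auto split: if_splits)
    have "count Q k = 0" if "odd k"
      using Q that by (auto simp: bounded_parts_def k_def not_in_iff[symmetric])
    then show ?thesis using Q \<open>k \<le> n\<close> unfolding P
      by (auto simp: bounded_parts_def partitions_no_rep_odd_def partitions_def k_def split: if_splits)
  qed
qed

definition parts_gf :: "nat \<Rightarrow> (nat multiset \<Rightarrow> int) \<Rightarrow> int fps" where
  "parts_gf m f = Abs_fps (\<lambda>n. \<Sum>P\<in>bounded_parts m n. f P)"

lemma parts_gf_Suc:
  fixes m
  defines "k \<equiv> Suc m"
  shows "parts_gf k f = parts_gf m f + fps_X ^ k * parts_gf (if even k then k else m) (\<lambda>P. f (add_mset k P))"
proof (rule fps_ext)
  fix n
  have "(\<Sum>P\<in>bounded_parts k n. f P) = (\<Sum>P\<in>bounded_parts m n. f P)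
    + (\<Sum>P\<in>(if k \<le> n then add_mset k ` bounded_parts (if even k then k else m) (n - k) else {}). f P)"
    unfolding k_def bounded_parts_Suc
    by (rule sum.union_disjoint, simp, simp) (auto simp: bounded_parts_def)
  also have "(\<Sum>P\<in>(if k \<le> n then add_mset k ` bounded_parts (if even k then k else m) (n - k) else {}). f P)
     = (if k \<le> n then \<Sum>P\<in>bounded_parts (if even k then k else m) (n - k). f (add_mset k P) else 0)"
    by (simp add: sum.reindex inj_on_def)
  finally show "fps_nth (parts_gf k f) n =
      fps_nth (parts_gf m f + fps_X ^ k * parts_gf (if even k then k else m) (\<lambda>P. f (add_mset k P))) n"
    by (simp add: parts_gf_def fps_X_power_mult_nth)
qed

definition even_minus_odd :: "nat multiset \<Rightarrow> int" where
  "even_minus_odd P = int (sum_mset (filter_mset even P)) - int (sum_mset (filter_mset odd P))"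

lemma even_minus_odd_add: "even_minus_odd (add_mset k P) = (-1) ^ k * int k + even_minus_odd P"
  by (simp add: even_minus_odd_def)

lemma parts_gf_add_const: "parts_gf m (\<lambda>P. c + f P) = fps_const c * parts_gf m (\<lambda>P. 1) + parts_gf m f"
  by (simp add: fps_eq_iff parts_gf_def sum.distrib)

definition theta :: "'a::comm_ring_1 fps \<Rightarrow> 'a fps" where
  "theta f = fps_X * fps_deriv f"

lemma theta_nth: "fps_nth (theta f) n = of_nat n * fps_nth f n"
  by (cases n) (auto simp: theta_def)

lemma theta_mult: "theta (f * g) = theta f * g + f * theta g"
  by (simp add: theta_def algebra_simps)

lemma theta_one_minus_power:
  "theta (1 - (- fps_X) ^ k) = - (of_nat k * (- fps_X) ^ k :: 'a::comm_ring_1 fps)"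
proof (cases k)
  case (Suc j)
  have "fps_deriv ((- fps_X) ^ k) = - (of_nat k * (- fps_X) ^ j :: 'a fps)"
    unfolding Suc by (subst fps_deriv_power') (simp add: algebra_simps)
  moreover have "theta (1 - f) = - (fps_X * fps_deriv f)" for f :: "'a fps"
    by (simp add: theta_def)
  ultimately have "theta (1 - (- fps_X) ^ k) = fps_X * (of_nat k * (- fps_X) ^ j :: 'a fps)"
    by (simp only: mult_minus_right minus_minus)
  then show ?thesis by (simp only: Suc power_Suc mult_minus_left mult_minus_right minus_minus mult_ac)
qed (simp add: theta_def)

text \<open>
  Raising \<open>m\<close> to an odd \<open>k\<close> multiplies the counting series \<open>C\<close> by \<open>1 + X\<^sup>k\<close>, an even \<open>k\<close> divides it by
  \<open>1 - X\<^sup>k\<close>. Against the square of \<open>e\<close> both become the factor \<open>1 - (-X)\<^sup>k\<close> of \<open>g\<close>, and the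
  contribution \<open>(-1)\<^sup>k k\<close> of the new part is exactly what the product rule for \<open>\<theta>\<close> produces.
\<close>
lemma parts_gf_product:
  fixes m :: nat
  defines "C \<equiv> \<lambda>m. parts_gf m (\<lambda>P. 1)" and "D \<equiv> \<lambda>m. parts_gf m even_minus_odd"
    and "e \<equiv> \<lambda>m. qpoch (fps_X\<^sup>2 :: int fps) (m div 2)" and "g \<equiv> qpoch (- fps_X :: int fps)"
  shows "C m * e m ^ 2 = g m" and "D m * e m ^ 2 = - theta (g m)"
proof -
  have "C m * e m ^ 2 = g m \<and> D m * e m ^ 2 = - theta (g m)"
  proof (induction m)
    case 0
    have "C 0 = 1" "D 0 = 0"
      by (auto simp: C_def D_def parts_gf_def fps_eq_iff bounded_parts_0 even_minus_odd_def)
    then show ?case by (simp add: e_def g_def theta_def)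
  next
    case (Suc m)
    define k where "k = Suc m"
    define x :: "int fps" where "x = fps_X ^ k"
    define y where "y = (- fps_X :: int fps) ^ k"
    define m' where "m' = (if even k then k else m)"
    have C: "C k = C m + x * C m'"
      unfolding C_def k_def x_def m'_def by (rule parts_gf_Suc)
    have "D k = D m + x * parts_gf m' (\<lambda>P. even_minus_odd (add_mset k P))"
      unfolding D_def k_def x_def m'_def by (rule parts_gf_Suc)
    moreover have "fps_const ((-1) ^ k * int k) = (of_int ((-1) ^ k) * of_nat k :: int fps)"
      by (simp only: fps_of_int[symmetric] fps_of_nat[symmetric] fps_const_mult of_int_eq_id id_apply)
    ultimately have D: "D k = D m + x * (of_int ((-1) ^ k) * of_nat k * C m' + D m')"
      by (simp add: even_minus_odd_add parts_gf_add_const C_def D_def del: fps_const_mult)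
    have g: "g k = g m * (1 - y)" by (simp add: g_def k_def y_def)
    have th: "theta (g k) = theta (g m) * (1 - y) - g m * (of_nat k * y)"
      unfolding g theta_mult by (simp add: y_def theta_one_minus_power)
    have IH: "C m * e m ^ 2 = g m" "D m * e m ^ 2 = - theta (g m)" using Suc by auto
    show ?case
    proof (cases "even k")
      case True
      then have y: "y = x" by (simp add: x_def y_def)
      have "k = Suc (Suc (2 * (m div 2)))" using True by (auto simp: k_def elim!: evenE)
      then have "k div 2 = Suc (m div 2)" and "(fps_X\<^sup>2) ^ Suc (m div 2) = x"
        unfolding x_def power_mult[symmetric] by simp_all
      then have e: "e k = e m * (1 - x)"
        unfolding e_def by (simp only: qpoch_Suc)
      have Ck: "C k * (1 - x) = C m" using C True by (simp add: m'_def algebra_simps)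
      have Dk: "D k * (1 - x) = D m + x * (of_nat k * C k)" using D True by (simp add: m'_def algebra_simps)
      have 1: "C k * e k ^ 2 = g k"
      proof -
        have "C k * e k ^ 2 = (C k * (1 - x)) * e m ^ 2 * (1 - x)"
          unfolding e by (simp add: power2_eq_square mult_ac)
        then show ?thesis unfolding Ck IH g y .
      qed
      have "D k * e k ^ 2 = (D k * (1 - x)) * e m ^ 2 * (1 - x)"
        unfolding e by (simp add: power2_eq_square mult_ac)
      also have "\<dots> = (D m * e m ^ 2) * (1 - x) + x * of_nat k * ((C k * (1 - x)) * e m ^ 2)"
        unfolding Dk by (simp add: algebra_simps)
      also have "\<dots> = - theta (g k)"
        unfolding Ck IH th y by (simp add: algebra_simps)
      finally show ?thesis using 1 by (simp add: k_def)
    next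
      case False
      then have y: "y = - x" by (simp add: x_def y_def)
      have "k div 2 = m div 2" using False by (auto simp: k_def)
      then have e: "e k = e m" by (simp add: e_def)
      have "C k * e k ^ 2 = C m * e m ^ 2 * (1 + x)"
        unfolding C e using False by (simp add: m'_def algebra_simps)
      moreover have "D k * e k ^ 2 = (D m * e m ^ 2) * (1 + x) - x * of_nat k * (C m * e m ^ 2)"
        unfolding D e using False by (simp add: m'_def algebra_simps)
      ultimately have "C k * e k ^ 2 = g k" "D k * e k ^ 2 = - theta (g k)"
        unfolding IH th unfolding g y by (simp_all add: algebra_simps)
      then show ?thesis by (simp add: k_def)
    qed
  qed
  then show "C m * e m ^ 2 = g m" "D m * e m ^ 2 = - theta (g m)" by auto
qed

definition sedo_sodo_gf :: "int fps" where
  "sedo_sodo_gf = Abs_fps (\<lambda>n. int (SEDO n) - int (SODO n))"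

lemma parts_gf_tendsto: "(\<lambda>m. parts_gf m even_minus_odd) \<longlonglongrightarrow> sedo_sodo_gf"
proof (rule tendsto_fpsI)
  fix n
  have "fps_nth (parts_gf m even_minus_odd) n = fps_nth sedo_sodo_gf n" if "n \<le> m" for m
    by (simp add: parts_gf_def sedo_sodo_gf_def bounded_parts_all[OF that] even_minus_odd_def SEDO_def SODO_def sum_subtractf)
  then show "\<forall>\<^sub>F m in sequentially. fps_nth (parts_gf m even_minus_odd) n = fps_nth sedo_sodo_gf n"
    unfolding eventually_sequentially by blast
qed

lemma tendsto_theta: "(f \<longlongrightarrow> A) F \<Longrightarrow> ((\<lambda>x. theta (f x)) \<longlongrightarrow> theta (A :: 'a::comm_ring_1 fps)) F"
  unfolding tendsto_fps_iff theta_nth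
proof
  fix n
  assume "\<forall>n. \<forall>\<^sub>F x in F. fps_nth (f x) n = fps_nth A n"
  then have "\<forall>\<^sub>F x in F. fps_nth (f x) n = fps_nth A n" ..
  then show "\<forall>\<^sub>F x in F. of_nat n * fps_nth (f x) n = of_nat n * fps_nth A n"
    by eventually_elim simp
qed

text \<open>
  For fixed \<open>n\<close>, bounding the parts by \<open>m \<ge> n\<close> is no restriction, so the exact identities for
  bounded parts pass to the limit.
\<close>
lemma sedo_sodo_gf_product:
  "sedo_sodo_gf * qpoch_inf (fps_X\<^sup>2) ^ 2 = - theta (qpoch_inf (- fps_X))"
proof (rule LIMSEQ_unique)
  have h: "filterlim (\<lambda>m. m div 2 :: nat) sequentially sequentially"
    unfolding filterlim_at_top eventually_sequentially
    by (metis div_le_mono nonzero_mult_div_cancel_left zero_neq_numeral)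
  show "(\<lambda>m. parts_gf m even_minus_odd * qpoch (fps_X\<^sup>2) (m div 2) ^ 2)
      \<longlonglongrightarrow> sedo_sodo_gf * qpoch_inf (fps_X\<^sup>2) ^ 2"
    by (intro tendsto_fps_mult tendsto_fps_power parts_gf_tendsto
        filterlim_compose[OF qpoch_tendsto h]) simp
  have "(\<lambda>m. -1 * theta (qpoch (- fps_X) m)) \<longlonglongrightarrow> -1 * theta (qpoch_inf (- fps_X :: int fps))"
    by (intro tendsto_fps_mult tendsto_const tendsto_theta qpoch_tendsto) simp
  then show "(\<lambda>m. parts_gf m even_minus_odd * qpoch (fps_X\<^sup>2) (m div 2) ^ 2)
      \<longlonglongrightarrow> - theta (qpoch_inf (- fps_X))"
    by (simp add: parts_gf_product)
qed

section \<open>Divisibility by seven\<close>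

text \<open>
  Applying \<open>\<theta>\<close> multiplies the coefficient of index \<open>N\<close> by \<open>N\<close>, which is invertible modulo \<open>p\<close>, whereas
  \<open>\<theta> (f\<^sup>p)\<close> is a multiple of \<open>p\<close>.
\<close>
lemma dvd_power_coeff_nonmultiple:
  fixes f :: "int fps"
  assumes p: "prime p" and N: "\<not> p dvd N"
  shows "int p dvd fps_nth (f ^ p) N"
proof -
  have "theta (f ^ p) = fps_const (int p) * (fps_X * fps_deriv f * f ^ (p - 1))"
    by (simp add: theta_def fps_deriv_power mult_ac)
  then have "int N * fps_nth (f ^ p) N = int p * fps_nth (fps_X * fps_deriv f * f ^ (p - 1)) N"
    using theta_nth[of "f ^ p" N] by (simp del: fps_mult_fps_X_deriv_shift)
  then have "int p dvd int N * fps_nth (f ^ p) N" by simp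
  moreover have "coprime (int p) (int N)"
    using p N by (simp add: prime_imp_coprime)
  ultimately show ?thesis by (simp add: coprime_dvd_mult_right_iff)
qed

text \<open>
  Modulo \<open>p\<close> the series \<open>f\<^sup>p\<close> involves only powers of \<open>X\<^sup>p\<close>, so the coefficients of \<open>f\<^sup>p D\<close> in the class of
  \<open>r\<close> are a unitriangular combination of those of \<open>D\<close> in the same class.
\<close>
lemma dvd_coeff_cancel_power:
  fixes f D :: "int fps"
  assumes p: "prime p" and f0: "fps_nth f 0 = 1" and r: "r < p"
    and fD: "\<And>n. int p dvd fps_nth (f ^ p * D) (p * n + r)"
  shows "int p dvd fps_nth D (p * n + r)"
proof (induction n rule: less_induct)
  case (less n)
  have "int p dvd fps_nth (f ^ p) i * fps_nth D (p * n + r - i)" if i: "i \<in> {1..p * n + r}" for i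
  proof (cases "p dvd i")
    case True
    then obtain m where m: "i = p * m" by blast
    have "m > 0" using i m by (cases m) auto
    have "p * m < p * Suc n" using i r m by auto
    then have "m \<le> n" by (metis mult_less_cancel1 less_Suc_eq_le)
    then have "p * n + r - i = p * (n - m) + r" using m by (simp add: diff_mult_distrib2)
    moreover have "n - m < n" using \<open>m > 0\<close> \<open>m \<le> n\<close> by simp
    ultimately show ?thesis using less by simp
  next
    case False
    then show ?thesis using dvd_power_coeff_nonmultiple[OF p] by simp
  qed
  then have "int p dvd (\<Sum>i=1..p * n + r. fps_nth (f ^ p) i * fps_nth D (p * n + r - i))"
    by (rule dvd_sum)
  moreover have "fps_nth (f ^ p * D) (p * n + r)
      = fps_nth D (p * n + r) + (\<Sum>i=1..p * n + r. fps_nth (f ^ p) i * fps_nth D (p * n + r - i))"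
    using f0 by (simp add: fps_mult_nth sum.atLeast_Suc_atMost[of 0] fps_nth_power_0)
  ultimately show ?case using fD[of n] by (simp only: dvd_add_left_iff)
qed

lemma theta_theta_series: "theta (theta_series w e) = theta_series (\<lambda>j. int (e j) * w j) e"
  by (rule fps_ext) (simp add: theta_nth theta_series_nth sum_distrib_left)

text \<open>
  The squares modulo \<open>7\<close> are \<open>0, 1, 2, 4\<close>. Modulo \<open>7\<close> the hypothesis reads \<open>3 x\<^sup>2 + y\<^sup>2 = 5\<close> for
  \<open>x = 2j + 1\<close> and \<open>y = 3m + 1\<close>, which leaves only \<open>x\<^sup>2 = 1, y\<^sup>2 = 2\<close> and \<open>x\<^sup>2 = 4, y = 0\<close>. In the first
  case the triangular number \<open>(x\<^sup>2 - 1)/8\<close> vanishes, in the second case the factor \<open>y\<close>.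
\<close>
lemma seven_dvd_weight:
  fixes m j :: int
  assumes N: "nat (3 * m\<^sup>2 + 2 * m) + tri j = 7 * n + 5"
  shows "7 dvd (3 * m + 1) * (int (tri j) * (2 * j + 1))"
proof -
  define x where "x = 2 * j + 1"
  define y where "y = 3 * m + 1"
  have T: "8 * int (tri j) = x\<^sup>2 - 1"
    using int_tri[of j] by (simp add: x_def power2_eq_square algebra_simps)
  have "int (nat (3 * m\<^sup>2 + 2 * m)) + int (tri j) = 7 * int n + 5"
    using N by linarith
  then have "3 * x\<^sup>2 + 8 * y\<^sup>2 = 7 * (24 * int n + 18) + 5"
    using T unfolding int_theta_exponents by (simp add: y_def power2_eq_square algebra_simps)
  then have form: "(3 * x\<^sup>2 + 8 * y\<^sup>2) mod 7 = 5"
    by (simp only: mod_mult_self4) simp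
  have residues: "b = 0 \<or> a = 1 \<or> a = 6"
    if "(3 * a\<^sup>2 + 8 * b\<^sup>2) mod 7 = 5" "a \<in> {0,1,2,3,4,5,6}" "b \<in> {0,1,2,3,4,5,6}" for a b :: int
    using that by auto
  have "(3 * (x mod 7)\<^sup>2 + 8 * (y mod 7)\<^sup>2) mod 7 = (3 * x\<^sup>2 + 8 * y\<^sup>2) mod 7"
    by (rule mod_add_cong[OF mod_mult_cong[OF refl power_mod] mod_mult_cong[OF refl power_mod]])
  moreover have "z mod 7 \<in> {0,1,2,3,4,5,6}" for z :: int
    by auto
  ultimately have "y mod 7 = 0 \<or> x mod 7 = 1 \<or> x mod 7 = 6"
    using form residues[of "x mod 7" "y mod 7"] by metis
  then have "7 dvd y \<or> 7 dvd (x - 1) * (x + 1)"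
  proof (elim disjE)
    assume "x mod 7 = 1" then have "7 dvd x - 1" by presburger
    then show ?thesis by simp
  next
    assume "x mod 7 = 6" then have "7 dvd x + 1" by presburger
    then show ?thesis by simp
  qed auto
  then show ?thesis
  proof
    assume "7 dvd y"
    then show ?thesis unfolding y_def by (rule dvd_mult2)
  next
    have eight: "7 dvd 8 * t \<Longrightarrow> 7 dvd t" for t :: int by presburger
    have "(x - 1) * (x + 1) = 8 * int (tri j)"
      unfolding T by (simp add: algebra_simps power2_eq_square)
    moreover assume "7 dvd (x - 1) * (x + 1)"
    ultimately have "7 dvd int (tri j)" using eight by metis
    then show ?thesis by (intro dvd_mult dvd_mult2)
  qed
qed

theorem theorem1p13:
  fixes n :: nat
  shows "[int (SEDO (7 * n + 5)) - int (SODO (7 * n + 5)) = 0] (mod 7)"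
proof -
  define G E :: "int fps" where "G = qpoch_inf (- fps_X)" and "E = qpoch_inf (fps_X\<^sup>2)"
  define D where "D = sedo_sodo_gf"
  define w where "w = (\<lambda>j. psgn j * (2 * j + 1) * (-1) ^ tri j)"
  have GE: "linear_theta * G\<^sup>2 = E ^ 5" unfolding G_def E_def by (rule linear_theta_product)
  have DE: "D * E\<^sup>2 = - theta G" unfolding G_def E_def D_def by (rule sedo_sodo_gf_product)
  have "2 * G ^ 3 = theta_series w tri"
    using jacobi_cube[of "-1" 1] by (simp add: G_def w_def flip: fps_const_neg)
  moreover have "theta (2 * G ^ 3) = 6 * G\<^sup>2 * theta G"
    by (simp add: theta_def fps_deriv_power')
  ultimately have th: "theta_series (\<lambda>j. int (tri j) * w j) tri = 6 * G\<^sup>2 * theta G"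
    by (simp flip: theta_theta_series)
  have main: "linear_theta * theta_series (\<lambda>j. int (tri j) * w j) tri = - 6 * (E ^ 7 * D)"
    unfolding th using GE DE by algebra
  have "7 dvd fps_nth (E ^ 7 * D) (7 * k + 5)" for k
  proof -
    have "7 dvd (case x of (m, j) \<Rightarrow> (3 * m + 1) * (int (tri j) * w j))"
      if "x \<in> {(m, j). nat (3 * m\<^sup>2 + 2 * m) + tri j = 7 * k + 5}" for x
    proof -
      obtain m j where x: "x = (m, j)" by (cases x)
      have "7 dvd (3 * m + 1) * (int (tri j) * (2 * j + 1)) * (psgn j * (-1) ^ tri j)"
        using that seven_dvd_weight[of m j k] by (metis (mono_tags, lifting) dvd_mult2 mem_Collect_eq prod.case x)
      then show ?thesis by (simp add: x w_def mult_ac)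
    qed
    then have "7 dvd fps_nth (linear_theta * theta_series (\<lambda>j. int (tri j) * w j) tri) (7 * k + 5)"
      unfolding linear_theta_def
      by (subst theta_series_mult_nth(1)[OF finite_linear_theta_fibre finite_tri_fibre]) (auto intro: dvd_sum)
    then have "7 dvd - 6 * fps_nth (E ^ 7 * D) (7 * k + 5)"
      unfolding main by (simp add: numeral_fps_const)
    then show ?thesis by presburger
  qed
  then have "7 dvd fps_nth D (7 * n + 5)"
    using dvd_coeff_cancel_power[of 7 E 5 D n] by (simp add: E_def qpoch_inf_nth_0)
  then show ?thesis by (simp add: D_def sedo_sodo_gf_def cong_0_iff)
qed

end
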